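(* Let $\Delta t>0$, $u_h^{-1}=u_h^0=\Pi u_0\in V_h$ and $U_h^{-1}=U_h^0=\Pi\sqrt{F(u_0)+B}\in V_h$. For $n\ge0$ put $u_h^{n,*}=2u_h^n-u_h^{n-1}$ and consider the scheme: given $u_h^{n-1},u_h^n,U_h^{n-1},U_h^n\in V_h$, find $(u_h^{n+1},w_h^{n+1},U_h^{n+1})\in V_h\times V_h\times V_h$ such that for all $\phi,\psi,\tau\in V_h$ $$\left(\frac{3u_h^{n+1}-4u_h^n+u_h^{n-1}}{2\Delta t},\phi\right)=-A(M(u_h^{n,*});w_h^{n+1},\phi),$$ $$(w_h^{n+1},\psi)=A(\epsilon^2;u_h^{n+1},\psi)+\left(H(u_h^{n,*})U_h^{n+1},\psi\right),$$ $$\left(\frac{3U_h^{n+1}-4U_h^n+U_h^{n-1}}{2\Delta t},\tau\right)=\left(\frac12H(u_h^{n,*})\frac{3u_h^{n+1}-4u_h^n+u_h^{n-1}}{2\Delta t},\tau\right).$$ Then for any $\Delta t>0$ the scheme admits a unique solution $(u_h^{n+1},w_h^{n+1},U_h^{n+1})\in V_h\times V_h\times V_h$. The solution satisfies total mass conservation $\int_\Omega u_h^n\,dx=\int_\Omega u_h^0\,dx$ for any $n>0$. Additionally, it satisfies, independently of the size of the time step $\Delta t$, the energy dissipation law $$\bar E_h^{n+1}=\bar E_h^n-\Delta t\,A(M(u_h^{n,*});w_h^{n+1},w_h^{n+1})-\frac14A(\epsilon^2;u_h^{n+1}-u_h^{n,*},u_h^{n+1}-u_h^{n,*})-\frac12\|U_h^{n+1}-U_h^{n,*}\|^2,$$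 where $\bar E_h^n=\frac12\left(E(u_h^n,U_h^n)+E(u_h^{n,*},U_h^{n,*})\right)$ and $U_h^{n,*}=2U_h^n-U_h^{n-1}$.
   Context: $\Omega\subset\mathbb{R}^d$ ($d=2,3$) is a bounded domain and $\epsilon>0$ is a constant. $\mathcal T$ is a quasi-uniform triangulation $\Omega=\cup_{i=1}^N T_i$, and $V_h=\{v\in C^0(\Omega)\cap H^1(\Omega): v|_{T_i}\in P_k\ \forall T_i\in\mathcal T\}$, where $P_k$ is the space of polynomials of degree at most $k$ ($k\ge1$ fixed). $C^0(\Omega)$ denotes functions continuous on $\overline\Omega$. $(\cdot,\cdot)$ and $\|\cdot\|$ are the $L^2(\Omega)$ inner product and norm. $\Pi$ is the $L^2(\Omega)$-orthogonal projection onto $V_h$. For a coefficient $a(x)$, $A(a;q,v)=\int_\Omega a(x)\nabla q\cdot\nabla v\,dx$. The potential $F$ is a $C^1$ function on an interval $I\subseteq\mathbb{R}$ (e.g. $F(u)=\frac14(u^2-1)^2$ with $I=\mathbb{R}$, or the logarithmic Flory–Huggins potential with $I=(0,1)$). The constant $B\ge0$ is such that $F+B>0$, and $H(w)=F'(w)/\sqrt{F(w)+B}$. The mobility $M\ge0$ is a continuous function. It is a standing assumption that all functions at which $F,F',H,M$ are evaluated take values (on $\overline\Omega$) where these are defined and $F+B>0$. $u_0$ is the given initial datum, with $u_0,\sqrt{F(u_0)+B}\in L^2(\Omega)$. The energy is $E(v,V)=\frac12A(\epsilon^2;v,v)+\int_\Omega V^2\,dx-B|\Omega|$. *)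

theory Defs
  imports "HOL-Analysis.Analysis"
begin

section \<open>Lebesgue and Sobolev spaces\<close>

definition L2 :: "(real^'d) set \<Rightarrow> ((real^'d) \<Rightarrow> real) set" where
  "L2 \<Omega> = {f. f \<in> borel_measurable (lebesgue_on \<Omega>) \<and>
              integrable (lebesgue_on \<Omega>) (\<lambda>x. (f x)\<^sup>2)}"

definition L2_inner :: "(real^'d) set \<Rightarrow> ((real^'d) \<Rightarrow> real) \<Rightarrow> ((real^'d) \<Rightarrow> real) \<Rightarrow> real" where
  "L2_inner \<Omega> f g = integral\<^sup>L (lebesgue_on \<Omega>) (\<lambda>x. f x * g x)"

definition L2_norm :: "(real^'d) set \<Rightarrow> ((real^'d) \<Rightarrow> real) \<Rightarrow> real" where
  "L2_norm \<Omega> f = sqrt (L2_inner \<Omega> f f)"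

definition partial_deriv :: "'d::finite \<Rightarrow> ((real^'d) \<Rightarrow> real) \<Rightarrow> (real^'d) \<Rightarrow> real" where
  "partial_deriv i f x = frechet_derivative f (at x) (axis i 1)"

primrec C_times :: "nat \<Rightarrow> ((real^'d::finite) \<Rightarrow> real) \<Rightarrow> bool" where
  "C_times 0 f \<longleftrightarrow> continuous_on UNIV f"
| "C_times (Suc m) f \<longleftrightarrow>
     (\<forall>x. f differentiable (at x)) \<and> (\<forall>i. C_times m (partial_deriv i f))"

text \<open>The space of smooth functions with compact support in \<open>\<Omega>\<close>, extended by zero to the
  whole space.\<close>

definition test_functions :: "(real^'d::finite) set \<Rightarrow> ((real^'d) \<Rightarrow> real) set" where
  "test_functions \<Omega> = {\<phi>. (\<forall>m. C_times m \<phi>) \<and>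
     (\<exists>K. compact K \<and> K \<subseteq> \<Omega> \<and> (\<forall>x. x \<notin> K \<longrightarrow> \<phi> x = 0))}"

definition is_weak_grad ::
  "(real^'d::finite) set \<Rightarrow> ((real^'d) \<Rightarrow> real) \<Rightarrow> ((real^'d) \<Rightarrow> real^'d) \<Rightarrow> bool" where
  "is_weak_grad \<Omega> v g \<longleftrightarrow>
     (\<forall>i. (\<lambda>x. g x $ i) \<in> L2 \<Omega> \<and>
       (\<forall>\<phi>\<in>test_functions \<Omega>.
          L2_inner \<Omega> v (partial_deriv i \<phi>) = - L2_inner \<Omega> (\<lambda>x. g x $ i) \<phi>))"

definition H1 :: "(real^'d::finite) set \<Rightarrow> ((real^'d) \<Rightarrow> real) set" where
  "H1 \<Omega> = {v \<in> L2 \<Omega>. \<exists>g. is_weak_grad \<Omega> v g}"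

text \<open>The weak gradient is only determined almost everywhere in \<open>\<Omega>\<close>; a representative is chosen,
  and the integrals in which it occurs do not depend on the choice.\<close>

definition weak_grad :: "(real^'d::finite) set \<Rightarrow> ((real^'d) \<Rightarrow> real) \<Rightarrow> (real^'d) \<Rightarrow> real^'d" where
  "weak_grad \<Omega> v = (SOME g. is_weak_grad \<Omega> v g)"

definition A_form :: "(real^'d::finite) set \<Rightarrow> ((real^'d) \<Rightarrow> real) \<Rightarrow>
    ((real^'d) \<Rightarrow> real) \<Rightarrow> ((real^'d) \<Rightarrow> real) \<Rightarrow> real" where
  "A_form \<Omega> a q v =
     integral\<^sup>L (lebesgue_on \<Omega>) (\<lambda>x. a x * (weak_grad \<Omega> q x \<bullet> weak_grad \<Omega> v x))"


section \<open>The finite element space\<close>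

text \<open>The simplices are closed, so a triangulation of the open set \<open>\<Omega>\<close> covers its closure. Each
  simplex contains a ball whose radius is at least \<open>\<rho>\<close> times the mesh size.\<close>

definition quasi_uniform_triangulation ::
  "real \<Rightarrow> (real^'d::finite) set set \<Rightarrow> (real^'d) set \<Rightarrow> bool" where
  "quasi_uniform_triangulation \<rho> \<T> \<Omega> \<longleftrightarrow>
     triangulation \<T> \<and> (\<forall>T\<in>\<T>. int CARD('d) simplex T) \<and> \<Union>\<T> = closure \<Omega> \<and>
     \<rho> > 0 \<and> (\<forall>T\<in>\<T>. \<exists>x. cball x (\<rho> * Max (diameter ` \<T>)) \<subseteq> T)"

definition poly_on :: "nat \<Rightarrow> (real^'d::finite) set \<Rightarrow> ((real^'d) \<Rightarrow> real) \<Rightarrow> bool" where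
  "poly_on k T v \<longleftrightarrow> (\<exists>c. \<forall>x\<in>T.
     v x = (\<Sum>\<alpha> | (\<Sum>i\<in>UNIV. \<alpha> i) \<le> k. c \<alpha> * (\<Prod>i\<in>UNIV. (x $ i) ^ \<alpha> i)))"

text \<open>Elements of the space are functions on the closure of \<open>\<Omega>\<close>. As HOL functions are total, they
  are normalised to be zero elsewhere, so that equality in the space is equality of functions.\<close>

definition Vh :: "nat \<Rightarrow> (real^'d::finite) set set \<Rightarrow> (real^'d) set \<Rightarrow> ((real^'d) \<Rightarrow> real) set" where
  "Vh k \<T> \<Omega> = {v. continuous_on (closure \<Omega>) v \<and> v \<in> H1 \<Omega> \<and> (\<forall>T\<in>\<T>. poly_on k T v) \<and>
     (\<forall>x. x \<notin> closure \<Omega> \<longrightarrow> v x = 0)}"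

definition L2_proj :: "(real^'d) set \<Rightarrow> ((real^'d) \<Rightarrow> real) set \<Rightarrow>
    ((real^'d) \<Rightarrow> real) \<Rightarrow> (real^'d) \<Rightarrow> real" where
  "L2_proj \<Omega> V f = (THE p. p \<in> V \<and> (\<forall>\<phi>\<in>V. L2_inner \<Omega> (\<lambda>x. f x - p x) \<phi> = 0))"


section \<open>The scheme\<close>

definition H_fun :: "(real \<Rightarrow> real) \<Rightarrow> (real \<Rightarrow> real) \<Rightarrow> real \<Rightarrow> real \<Rightarrow> real" where
  "H_fun F F' B s = F' s / sqrt (F s + B)"

text \<open>Here and below the arguments are ordered by increasing time level. In \<open>extrap\<close> they
  are the levels \<open>n-1\<close>, \<open>n\<close>; in \<open>bdf2\<close> the levels \<open>n-1\<close>, \<open>n\<close>, \<open>n+1\<close>.\<close>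

definition extrap :: "((real^'d) \<Rightarrow> real) \<Rightarrow> ((real^'d) \<Rightarrow> real) \<Rightarrow> (real^'d) \<Rightarrow> real" where
  "extrap a b = (\<lambda>x. 2 * b x - a x)"

definition bdf2 :: "real \<Rightarrow> ((real^'d) \<Rightarrow> real) \<Rightarrow> ((real^'d) \<Rightarrow> real) \<Rightarrow>
    ((real^'d) \<Rightarrow> real) \<Rightarrow> (real^'d) \<Rightarrow> real" where
  "bdf2 dt a b c = (\<lambda>x. (3 * c x - 4 * b x + a x) / (2 * dt))"

text \<open>The extrapolation \<open>2 u(n) - u(n-1)\<close> must take values where \<open>F\<close>, \<open>F'\<close>, \<open>H\<close> and \<open>M\<close> are defined;
  the domains of \<open>F\<close> and \<open>M\<close> are \<open>I\<close> and \<open>J\<close>.\<close>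

definition admissible :: "(real \<Rightarrow> real) \<Rightarrow> real \<Rightarrow> real set \<Rightarrow> real set \<Rightarrow>
    (real^'d) set \<Rightarrow> ((real^'d) \<Rightarrow> real) \<Rightarrow> bool" where
  "admissible F B I J \<Omega> v \<longleftrightarrow> (\<forall>x\<in>closure \<Omega>. v x \<in> I \<and> F (v x) + B > 0 \<and> v x \<in> J)"

text \<open>\<open>(u, w, U)\<close> is the solution at level \<open>n+1\<close>, given \<open>u0, U0\<close> at level \<open>n-1\<close> and
  \<open>u1, U1\<close> at level \<open>n\<close>.\<close>

definition scheme_step :: "(real^'d::finite) set \<Rightarrow> ((real^'d) \<Rightarrow> real) set \<Rightarrow> real \<Rightarrow>
    (real \<Rightarrow> real) \<Rightarrow> (real \<Rightarrow> real) \<Rightarrow> real \<Rightarrow>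
    ((real^'d) \<Rightarrow> real) \<Rightarrow> ((real^'d) \<Rightarrow> real) \<Rightarrow> ((real^'d) \<Rightarrow> real) \<Rightarrow> ((real^'d) \<Rightarrow> real) \<Rightarrow>
    ((real^'d) \<Rightarrow> real) \<Rightarrow> ((real^'d) \<Rightarrow> real) \<Rightarrow> ((real^'d) \<Rightarrow> real) \<Rightarrow> bool" where
  "scheme_step \<Omega> V \<epsilon> M H dt u0 u1 U0 U1 u w U \<longleftrightarrow>
     u \<in> V \<and> w \<in> V \<and> U \<in> V \<and>
     (\<forall>\<phi>\<in>V. L2_inner \<Omega> (bdf2 dt u0 u1 u) \<phi> = - A_form \<Omega> (\<lambda>x. M (extrap u0 u1 x)) w \<phi>) \<and>
     (\<forall>\<psi>\<in>V. L2_inner \<Omega> w \<psi> = A_form \<Omega> (\<lambda>x. \<epsilon>\<^sup>2) u \<psi> +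
                 L2_inner \<Omega> (\<lambda>x. H (extrap u0 u1 x) * U x) \<psi>) \<and>
     (\<forall>\<tau>\<in>V. L2_inner \<Omega> (bdf2 dt U0 U1 U) \<tau> =
                 L2_inner \<Omega> (\<lambda>x. 1/2 * H (extrap u0 u1 x) * bdf2 dt u0 u1 u x) \<tau>)"

text \<open>A discrete trajectory with \<open>N\<close> computed steps. Time levels are integers starting at \<open>-1\<close>;
  only \<open>u n\<close> and \<open>U n\<close> for \<open>-1 \<le> n \<le> N\<close> and \<open>w n\<close> for \<open>1 \<le> n \<le> N\<close> are constrained.\<close>

definition scheme_solution :: "(real^'d::finite) set \<Rightarrow> ((real^'d) \<Rightarrow> real) set \<Rightarrow> real \<Rightarrow>
    (real \<Rightarrow> real) \<Rightarrow> (real \<Rightarrow> real) \<Rightarrow> (real \<Rightarrow> real) \<Rightarrow> real \<Rightarrow> real set \<Rightarrow> real set \<Rightarrow> real \<Rightarrow>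
    ((real^'d) \<Rightarrow> real) \<Rightarrow> int \<Rightarrow> (int \<Rightarrow> (real^'d) \<Rightarrow> real) \<Rightarrow>
    (int \<Rightarrow> (real^'d) \<Rightarrow> real) \<Rightarrow> (int \<Rightarrow> (real^'d) \<Rightarrow> real) \<Rightarrow> bool" where
  "scheme_solution \<Omega> V \<epsilon> M F F' B I J dt u_init N u w U \<longleftrightarrow>
     u (-1) = L2_proj \<Omega> V u_init \<and> u 0 = L2_proj \<Omega> V u_init \<and>
     U (-1) = L2_proj \<Omega> V (\<lambda>x. sqrt (F (u_init x) + B)) \<and>
     U 0 = L2_proj \<Omega> V (\<lambda>x. sqrt (F (u_init x) + B)) \<and>
     (\<forall>n. 0 \<le> n \<and> n < N \<longrightarrow>
        admissible F B I J \<Omega> (extrap (u (n - 1)) (u n)) \<and>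
        scheme_step \<Omega> V \<epsilon> M (H_fun F F' B) dt
          (u (n - 1)) (u n) (U (n - 1)) (U n) (u (n + 1)) (w (n + 1)) (U (n + 1)))"


section \<open>The energy\<close>

definition energy :: "(real^'d::finite) set \<Rightarrow> real \<Rightarrow> real \<Rightarrow>
    ((real^'d) \<Rightarrow> real) \<Rightarrow> ((real^'d) \<Rightarrow> real) \<Rightarrow> real" where
  "energy \<Omega> \<epsilon> B v V = 1/2 * A_form \<Omega> (\<lambda>x. \<epsilon>\<^sup>2) v v +
     integral\<^sup>L (lebesgue_on \<Omega>) (\<lambda>x. (V x)\<^sup>2) - B * measure lebesgue \<Omega>"

definition mean_energy :: "(real^'d::finite) set \<Rightarrow> real \<Rightarrow> real \<Rightarrow>
    (int \<Rightarrow> (real^'d) \<Rightarrow> real) \<Rightarrow> (int \<Rightarrow> (real^'d) \<Rightarrow> real) \<Rightarrow> int \<Rightarrow> real" where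
  "mean_energy \<Omega> \<epsilon> B u U n = 1/2 * (energy \<Omega> \<epsilon> B (u n) (U n) +
     energy \<Omega> \<epsilon> B (extrap (u (n - 1)) (u n)) (extrap (U (n - 1)) (U n)))"

end

theory Submission
  imports Defs
begin

text \<open>
  The scheme is linear in its unknowns \<open>(u, w, U)\<close>, and its three equations, tested with elements of
  \<open>V\<^sub>h\<close>, form a square system because \<open>V\<^sub>h\<close> is finite dimensional. So existence and uniqueness
  both follow once the homogeneous system is seen to be trivial. There, testing with
  \<open>(w, u, U)\<close> makes the coupling terms cancel, so that a combination with positive weights of the nonnegative
  quantities \<open>A(\<epsilon>\<^sup>2; u, u)\<close>, \<open>(U, U)\<close> and \<open>A(M; w, w)\<close> is zero. Hence \<open>U = 0\<close>. The other two
  vanish as seminorms, so they also vanish when paired with any other element, and the first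
  equation then gives \<open>u = 0\<close> and the second \<open>w = 0\<close>.

  The energy law comes from testing in the same spirit: with \<open>\<delta>u\<close>, \<open>\<delta>U\<close> the discrete time
  derivatives, testing with \<open>(w, \<delta>u, U)\<close> gives
  \<open>-A(M; w, w) = A(\<epsilon>\<^sup>2; \<delta>u, u) + 2 (\<delta>U, U)\<close>, and each term on the right is turned into a
  difference of the squares at two successive levels plus one nonnegative square by the algebraic identity behind the two-step backward differentiation
  formula (\<open>bdf2_identity\<close>), which holds for every symmetric bilinear form. Mass conservation comes
  from testing the first equation with the constant function.

  All of this uses that \<open>A\<close> is bilinear on \<open>V\<^sub>h\<close> and that constants have zero gradient. Since
  the weak gradient is a chosen representative, this rests on its being unique almost everywhere,
  that is, on the fundamental lemma of the calculus of variations, and on the fact that the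
  integral of a partial derivative of a test function is zero.
\<close>

section \<open>Smooth functions and bumps\<close>

lemma partial_deriv_eqI:
  assumes "(f has_derivative D) (at x)"
  shows "partial_deriv i f x = D (axis i 1)"
  using frechet_derivative_at[OF assms] by (simp add: partial_deriv_def)

lemma C_times_Suc_imp_has_derivative:
  "C_times (Suc m) f \<Longrightarrow> (f has_derivative frechet_derivative f (at x)) (at x)"
  by (simp add: frechet_derivative_works)

lemma C_times_SucD: "C_times (Suc m) f \<Longrightarrow> C_times m f"
proof (induction m arbitrary: f)
  case 0
  then show ?case
    by (auto simp: differentiable_imp_continuous_within continuous_on_eq_continuous_within)
next
  case (Suc m)
  then show ?case by auto
qed

lemma C_times_const: "C_times m (\<lambda>x. c)"
proof (induction m arbitrary: c)
  case (Suc m)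
  have "partial_deriv i (\<lambda>x. c) = (\<lambda>x. 0)" for i :: 'a
    by (simp add: partial_deriv_def fun_eq_iff)
  with Suc show ?case by simp
qed simp

lemma C_times_add:
  assumes "C_times m f" "C_times m g"
  shows "C_times m (\<lambda>x. f x + g x)"
  using assms
proof (induction m arbitrary: f g)
  case (Suc m)
  have "partial_deriv i (\<lambda>x. f x + g x) = (\<lambda>x. partial_deriv i f x + partial_deriv i g x)" for i
  proof
    fix x
    have "((\<lambda>x. f x + g x) has_derivative
        (\<lambda>h. frechet_derivative f (at x) h + frechet_derivative g (at x) h)) (at x)"
      by (intro has_derivative_add C_times_Suc_imp_has_derivative[OF Suc.prems(1)]
          C_times_Suc_imp_has_derivative[OF Suc.prems(2)])
    from partial_deriv_eqI[OF this]
    show "partial_deriv i (\<lambda>x. f x + g x) x = partial_deriv i f x + partial_deriv i g x"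
      by (simp add: partial_deriv_def)
  qed
  then show ?case using Suc by auto
qed (auto intro: continuous_intros)

text \<open>
  The product rule for one derivative involves the undifferentiated factors as well, which is why
  the induction needs \<open>C_times_SucD\<close>.
\<close>

lemma C_times_mult:
  assumes "C_times m f" "C_times m g"
  shows "C_times m (\<lambda>x. f x * g x)"
  using assms
proof (induction m arbitrary: f g)
  case (Suc m)
  have "partial_deriv i (\<lambda>x. f x * g x) = (\<lambda>x. f x * partial_deriv i g x + partial_deriv i f x * g x)" for i
  proof
    fix x
    have "((\<lambda>x. f x * g x) has_derivative
        (\<lambda>h. f x * frechet_derivative g (at x) h + frechet_derivative f (at x) h * g x)) (at x)"
      by (intro has_derivative_mult C_times_Suc_imp_has_derivative[OF Suc.prems(1)]
          C_times_Suc_imp_has_derivative[OF Suc.prems(2)])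
    from partial_deriv_eqI[OF this]
    show "partial_deriv i (\<lambda>x. f x * g x) x = f x * partial_deriv i g x + partial_deriv i f x * g x"
      by (simp add: partial_deriv_def)
  qed
  moreover have "C_times m (\<lambda>x. f x * partial_deriv i g x + partial_deriv i f x * g x)" for i
    using Suc.prems by (intro C_times_add Suc.IH C_times_SucD[OF Suc.prems(1)] C_times_SucD[OF Suc.prems(2)]) auto
  ultimately show ?case using Suc.prems by auto
qed (auto intro: continuous_intros)

lemma C_times_sum: "(\<And>j. j \<in> A \<Longrightarrow> C_times m (f j)) \<Longrightarrow> C_times m (\<lambda>x. \<Sum>j\<in>A. f j x)"
  by (induction A rule: infinite_finite_induct) (auto intro: C_times_add C_times_const)

lemma C_times_prod: "(\<And>j. j \<in> A \<Longrightarrow> C_times m (f j)) \<Longrightarrow> C_times m (\<lambda>x. \<Prod>j\<in>A. f j x)"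
  by (induction A rule: infinite_finite_induct) (auto intro: C_times_mult C_times_const)

lemma partial_deriv_chain:
  assumes "(f has_derivative frechet_derivative f (at x)) (at x)"
    and "(g has_real_derivative d) (at (f x))"
  shows "((\<lambda>x. g (f x)) has_derivative (\<lambda>h. d * frechet_derivative f (at x) h)) (at x)"
    and "partial_deriv i (\<lambda>x. g (f x)) x = d * partial_deriv i f x"
proof -
  show *: "((\<lambda>x. g (f x)) has_derivative (\<lambda>h. d * frechet_derivative f (at x) h)) (at x)"
    using diff_chain_at[OF assms(1) assms(2)[unfolded has_field_derivative_def]]
    by (simp add: o_def)
  show "partial_deriv i (\<lambda>x. g (f x)) x = d * partial_deriv i f x"
    using partial_deriv_eqI[OF *] by (simp add: partial_deriv_def)
qed

lemma C_times_exp: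
  assumes "C_times m f"
  shows "C_times m (\<lambda>x. exp (f x))"
  using assms
proof (induction m arbitrary: f)
  case (Suc m)
  note ch = partial_deriv_chain[OF C_times_Suc_imp_has_derivative[OF Suc.prems] DERIV_exp]
  have "C_times m (\<lambda>x. exp (f x) * partial_deriv i f x)" for i
    using Suc.prems by (intro C_times_mult Suc.IH C_times_SucD[OF Suc.prems]) auto
  moreover have "partial_deriv i (\<lambda>x. exp (f x)) = (\<lambda>x. exp (f x) * partial_deriv i f x)" for i
    using ch(2) by blast
  ultimately show ?case using ch(1) by (auto simp: differentiable_def)
qed (auto intro: continuous_intros)

lemma C_times_affine:
  fixes i :: "'d::finite"
  shows "C_times m (\<lambda>x. s * x $ i + c)"
proof (cases m)
  case (Suc l)
  have d: "((\<lambda>x. s * x $ i + c) has_derivative (\<lambda>h. s * h $ i)) (at x)" for x :: "real^'d"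
    by (auto intro!: derivative_eq_intros bounded_linear.has_derivative[OF bounded_linear_vec_nth])
  have "partial_deriv j (\<lambda>x. s * x $ i + c) = (\<lambda>x. s * axis j 1 $ i)" for j
    using partial_deriv_eqI[OF d] by blast
  then show ?thesis using d by (auto simp: Suc C_times_const differentiable_def)
qed (auto intro!: continuous_intros)

text \<open>
  For \<open>k = 0\<close> this is the classical smooth function that vanishes to infinite order at \<open>0\<close>. The
  powers of \<open>1 / t\<close> are included because the family is then closed under differentiation up to
  linear combinations, which lets \<open>C_times_flat\<close> be proved by induction for all \<open>k\<close> at once.
\<close>

definition flat :: "nat \<Rightarrow> real \<Rightarrow> real" where
  "flat k t = (if t > 0 then (1 / t) ^ k * exp (- (1 / t)) else 0)"

lemma flat_tendsto_0: "(flat k \<longlongrightarrow> 0) (at 0)"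
proof -
  have "((\<lambda>t::real. (1 / t) ^ k * exp (- (1 / t))) \<longlongrightarrow> 0) (at_right 0)"
    using filterlim_compose[OF tendsto_power_div_exp_0[of k] filterlim_inverse_at_top_right]
    by (simp add: exp_minus field_simps)
  then have "(flat k \<longlongrightarrow> 0) (at_right 0)"
    by (rule Lim_transform_eventually) (auto simp: flat_def eventually_at_filter)
  moreover have "(flat k \<longlongrightarrow> 0) (at_left 0)"
    by (rule tendsto_eventually) (auto simp: flat_def eventually_at_filter)
  ultimately show ?thesis by (simp add: filterlim_at_split)
qed

lemma flat_has_derivative:
  "(flat k has_real_derivative (flat (k + 2) t - k * flat (k + 1) t)) (at t)"
proof (cases t "0::real" rule: linorder_cases)
  case greater
  have "((\<lambda>t. (1 / t) ^ k * exp (- (1 / t))) has_real_derivative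
      (flat (k + 2) t - k * flat (k + 1) t)) (at t)"
    using greater
    apply (cases k)
     apply (auto intro!: derivative_eq_intros simp: flat_def field_simps power2_eq_square)
    subgoal for j by (cases j) auto
    done
  then show ?thesis
    by (rule has_field_derivative_transform_within_open[of _ _ _ "{0<..}"])
      (use greater in \<open>auto simp: flat_def\<close>)
next
  case less
  have "((\<lambda>t. 0) has_real_derivative (flat (k + 2) t - k * flat (k + 1) t)) (at t)"
    using less by (simp add: flat_def)
  then show ?thesis
    by (rule has_field_derivative_transform_within_open[of _ _ _ "{..<0}"])
      (use less in \<open>auto simp: flat_def\<close>)
next
  case equal
  have "(\<lambda>y. (flat k y - flat k 0) / (y - 0)) = flat (k + 1)"
    by (auto simp: flat_def fun_eq_iff)
  with flat_tendsto_0[of "k+1"] show ?thesis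
    by (simp add: equal has_field_derivative_iff) (simp add: flat_def)
qed

lemma C_times_flat:
  assumes "C_times m f"
  shows "C_times m (\<lambda>x. flat k (f x))"
  using assms
proof (induction m arbitrary: f k)
  case 0
  have "continuous_on UNIV (flat k)"
    using flat_has_derivative by (meson DERIV_continuous continuous_at_imp_continuous_on)
  with 0 show ?case by (auto intro: continuous_on_compose2)
next
  case (Suc m)
  note ch = partial_deriv_chain[OF C_times_Suc_imp_has_derivative[OF Suc.prems] flat_has_derivative]
  have "C_times m (\<lambda>x. (flat (k + 2) (f x) + (- real k) * flat (k + 1) (f x)) * partial_deriv i f x)" for i
    using Suc.prems
    by (intro C_times_mult C_times_add C_times_const Suc.IH C_times_SucD[OF Suc.prems]) auto
  moreover have "partial_deriv i (\<lambda>x. flat k (f x)) =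
      (\<lambda>x. (flat (k + 2) (f x) + (- real k) * flat (k + 1) (f x)) * partial_deriv i f x)" for i
    by (simp add: fun_eq_iff ch(2))
  ultimately have "C_times m (partial_deriv i (\<lambda>x. flat k (f x)))" for i
    by simp
  then show ?case using ch(1) by (auto simp: differentiable_def)
qed

definition box_bump :: "real^'d::finite \<Rightarrow> real^'d \<Rightarrow> real^'d \<Rightarrow> real" where
  "box_bump a b x = (\<Prod>i\<in>UNIV. flat 0 (x $ i - a $ i) * flat 0 (b $ i - x $ i))"

lemma C_times_box_bump: "C_times m (box_bump a b)"
proof -
  have *: "C_times m (\<lambda>x. \<Prod>i\<in>UNIV. flat 0 (1 * x $ i + (- a $ i)) * flat 0 ((-1) * x $ i + b $ i))"
    by (intro C_times_prod C_times_mult C_times_flat C_times_affine)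
  show ?thesis
    by (rule back_subst[of "C_times m", OF *]) (auto simp: box_bump_def fun_eq_iff)
qed

lemma box_bump_nonneg: "box_bump a b x \<ge> 0"
  by (auto simp: box_bump_def flat_def intro!: prod_nonneg)

lemma box_bump_pos_iff: "box_bump a b x > 0 \<longleftrightarrow> x \<in> box a b"
proof -
  have "box_bump a b x \<noteq> 0 \<longleftrightarrow> x \<in> box a b"
    by (auto simp: box_bump_def flat_def mem_box_cart)
  then show ?thesis using box_bump_nonneg[of a b x] by linarith
qed

section \<open>The fundamental lemma of the calculus of variations\<close>

text \<open>
  The closed boxes have to lie in \<open>U\<close> because they become supports of test functions, while it is
  the open boxes, on which the bumps are positive, that have to cover \<open>U\<close>.
\<close>

lemma open_eq_Union_boxes:
  fixes U :: "(real^'d::finite) set"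
  assumes "open U"
  obtains a b :: "nat \<Rightarrow> real^'d"
  where "\<And>n. cbox (a n) (b n) \<subseteq> U" "U = (\<Union>n. box (a n) (b n))"
proof -
  define \<F> where "\<F> = {box a b | a b. cbox a b \<subseteq> U}"
  have "U = \<Union>\<F>"
  proof
    show "U \<subseteq> \<Union>\<F>"
    proof
      fix x assume "x \<in> U"
      with assms obtain e where e: "e > 0" "cball x e \<subseteq> U"
        using open_contains_cball by blast
      obtain a b where ab: "x \<in> box a b" "box a b \<subseteq> ball x e"
        using rational_boxes[OF e(1)] by metis
      have "cbox a b = closure (box a b)"
        using ab(1) by (subst closure_box) auto
      also have "\<dots> \<subseteq> cball x e"
        using ab(2) ball_subset_cball by (intro closure_minimal) auto
      finally show "x \<in> \<Union>\<F>"
        using ab(1) e(2) unfolding \<F>_def by blast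
    qed
    show "\<Union>\<F> \<subseteq> U"
      using box_subset_cbox by (fastforce simp: \<F>_def)
  qed
  obtain \<G> where \<G>: "\<G> \<subseteq> \<F>" "countable \<G>" "\<Union>\<G> = \<Union>\<F>"
    by (rule Lindelof[of \<F>]) (auto simp: \<F>_def)
  define \<H> where "\<H> = insert {} \<G>"
  \<comment> \<open>The empty box is added so that the family can be enumerated even if \<open>U\<close> is empty.\<close>
  have "\<H> \<subseteq> \<F>"
  proof -
    have "box (1::real^'d) 0 = {}" "cbox (1::real^'d) 0 = {}"
      by (simp_all add: interval_eq_empty_cart)
    then have "{} \<in> \<F>" unfolding \<F>_def by (intro CollectI exI[of _ 1] exI[of _ 0]) simp
    then show ?thesis using \<G>(1) by (simp add: \<H>_def)
  qed
  then have "\<forall>n. \<exists>a b. from_nat_into \<H> n = box a b \<and> cbox a b \<subseteq> U"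
    using from_nat_into[of \<H>] unfolding \<H>_def \<F>_def by blast
  then obtain a b where ab: "\<And>n. from_nat_into \<H> n = box (a n) (b n)" "\<And>n. cbox (a n) (b n) \<subseteq> U"
    by metis
  have "U = \<Union>\<H>" using \<open>U = \<Union>\<F>\<close> \<G>(3) by (simp add: \<H>_def)
  also have "\<dots> = (\<Union>n. box (a n) (b n))"
    unfolding ab(1)[symmetric]
    by (subst range_from_nat_into) (use \<G>(2) in \<open>auto simp: \<H>_def\<close>)
  finally show ?thesis using that ab(2) by blast
qed

text \<open>
  If \<open>p \<ge> 0\<close> is smooth, then \<open>1 - exp (-n p)\<close> is smooth, vanishes exactly where \<open>p\<close> does, takes
  values in \<open>[0, 1)\<close> and tends to the indicator of \<open>{p > 0}\<close>. Taking for \<open>p\<close> the sum of the bumps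
  of the first \<open>n\<close> boxes that exhaust \<open>U\<close> keeps the support compact for each \<open>n\<close> and still
  reaches every point of \<open>U\<close> in the limit.
\<close>

lemma test_functions_tendsto_indicator:
  fixes U :: "(real^'d::finite) set"
  assumes "open U" "U \<subseteq> \<Omega>"
  obtains \<phi> where "\<And>n. \<phi> n \<in> test_functions \<Omega>" "\<And>n x. \<bar>\<phi> n x\<bar> \<le> 1"
    "\<And>x. (\<lambda>n. \<phi> n x) \<longlonglongrightarrow> indicator U x"
proof -
  obtain a b :: "nat \<Rightarrow> real^'d"
    where ab: "\<And>n. cbox (a n) (b n) \<subseteq> U" "U = (\<Union>n. box (a n) (b n))"
    using open_eq_Union_boxes[OF assms(1)] by blast
  define p where "p n x = (\<Sum>j<n. box_bump (a j) (b j) x)" for n x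
  define \<phi> where "\<phi> n x = 1 + (-1) * exp ((- real n) * p n x)" for n x
  have p_nonneg: "p n x \<ge> 0" for n x
    by (simp add: p_def sum_nonneg box_bump_nonneg)
  show thesis
  proof
    show "\<phi> n \<in> test_functions \<Omega>" for n
      unfolding test_functions_def
    proof (intro CollectI conjI allI exI impI)
      show "C_times m (\<phi> n)" for m
        unfolding \<phi>_def p_def
        by (intro C_times_add C_times_const C_times_mult C_times_exp C_times_sum C_times_box_bump)
      show "compact (\<Union>j<n. cbox (a j) (b j))"
        by (intro compact_UN) auto
      show "(\<Union>j<n. cbox (a j) (b j)) \<subseteq> \<Omega>"
        using ab(1) assms(2) by blast
      fix x assume "x \<notin> (\<Union>j<n. cbox (a j) (b j))"
      then have "box_bump (a j) (b j) x = 0" if "j < n" for j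
        using that box_bump_pos_iff[of "a j" "b j" x] box_bump_nonneg[of "a j" "b j" x]
          box_subset_cbox[of "a j" "b j"] by fastforce
      then show "\<phi> n x = 0" by (simp add: \<phi>_def p_def)
    qed
    show "\<bar>\<phi> n x\<bar> \<le> 1" for n x
    proof -
      have "exp ((- real n) * p n x) \<le> 1" "exp ((- real n) * p n x) > 0"
        using p_nonneg[of n x] by simp_all
      then show ?thesis unfolding \<phi>_def by linarith
    qed
    show "(\<lambda>n. \<phi> n x) \<longlonglongrightarrow> indicator U x" for x
    proof (cases "x \<in> U")
      case True
      then obtain j where j: "x \<in> box (a j) (b j)" using ab(2) by auto
      define c where "c = box_bump (a j) (b j) x"
      have "c > 0" using j by (simp add: c_def box_bump_pos_iff)
      have le: "c \<le> p n x" if "n > j" for n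
        unfolding c_def p_def using that by (intro member_le_sum) (auto simp: box_bump_nonneg)
      have "(\<lambda>n. exp (- (real n * c))) \<longlonglongrightarrow> 0"
        using \<open>c > 0\<close> by real_asymp
      then have "(\<lambda>n. exp ((- real n) * p n x)) \<longlonglongrightarrow> 0"
      proof (rule tendsto_sandwich[OF _ _ tendsto_const, rotated 2])
        show "\<forall>\<^sub>F n in sequentially. exp ((- real n) * p n x) \<le> exp (- (real n * c))"
          using eventually_gt_at_top[of j]
          by eventually_elim (use le in \<open>simp add: mult_left_mono\<close>)
      qed auto
      then have "(\<lambda>n. 1 + (-1) * exp ((- real n) * p n x)) \<longlonglongrightarrow> 1 + (-1) * 0"
        by (intro tendsto_intros)
      then show ?thesis using True by (simp add: \<phi>_def)
    next
      case False
      then have "box_bump (a j) (b j) x = 0" for j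
        using ab box_bump_pos_iff[of "a j" "b j" x] box_bump_nonneg[of "a j" "b j" x] by fastforce
      then show ?thesis using False by (simp add: \<phi>_def p_def)
    qed
  qed
qed

lemma dominated_by_integrable_factor:
  fixes f :: "'a \<Rightarrow> real"
  assumes f: "integrable M f" and g: "\<And>n. g n \<in> borel_measurable M" "\<And>n x. \<bar>g n x\<bar> \<le> 1"
    and lim: "\<And>x. x \<in> space M \<Longrightarrow> (\<lambda>n. g n x) \<longlonglongrightarrow> h x"
    and zero: "\<And>n. (\<integral>x. f x * g n x \<partial>M) = 0"
  shows "(\<integral>x. f x * h x \<partial>M) = 0"
proof -
  have [measurable]: "f \<in> borel_measurable M" "\<And>n. g n \<in> borel_measurable M"
    using f g by auto
  have [measurable]: "h \<in> borel_measurable M"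
    by (rule borel_measurable_LIMSEQ_metric[OF g(1) lim])
  have "(\<lambda>n. \<integral>x. f x * g n x \<partial>M) \<longlonglongrightarrow> (\<integral>x. f x * h x \<partial>M)"
  proof (rule integral_dominated_convergence[where w = "\<lambda>x. \<bar>f x\<bar>"])
    show "AE x in M. norm (f x * g n x) \<le> \<bar>f x\<bar>" for n
      using g(2) by (simp add: abs_mult mult_left_le)
    show "AE x in M. (\<lambda>n. f x * g n x) \<longlonglongrightarrow> f x * h x"
      using lim by (intro AE_I2 tendsto_intros)
  qed (use f in auto)
  with zero show ?thesis
    by (simp add: LIMSEQ_const_iff)
qed

lemma test_function_continuous:
  "\<phi> \<in> test_functions \<Omega> \<Longrightarrow> continuous_on S \<phi>"
  unfolding test_functions_def using C_times.simps(1) continuous_on_subset by blast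

text \<open>
  Orthogonality to test functions passes to indicators of open sets, then of countable
  intersections of open sets by dominated convergence, and then of all Lebesgue measurable sets,
  which differ from such intersections by null sets.
\<close>

theorem fundamental_lemma_calculus_of_variations:
  fixes f :: "real^'d::finite \<Rightarrow> real"
  assumes "open \<Omega>" and f: "integrable (lebesgue_on \<Omega>) f"
    and orth: "\<And>\<phi>. \<phi> \<in> test_functions \<Omega> \<Longrightarrow> (\<integral>x. f x * \<phi> x \<partial>lebesgue_on \<Omega>) = 0"
  shows "AE x in lebesgue_on \<Omega>. f x = 0"
proof -
  let ?M = "lebesgue_on \<Omega>"
  have \<Omega>: "\<Omega> \<in> sets lebesgue" using \<open>open \<Omega>\<close> by simp
  have on_open: "(\<integral>x. f x * indicator U x \<partial>?M) = 0" if U: "open U" for U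
  proof -
    obtain \<phi> where \<phi>: "\<And>n. \<phi> n \<in> test_functions \<Omega>" "\<And>n x. \<bar>\<phi> n x\<bar> \<le> 1"
      "\<And>x. (\<lambda>n. \<phi> n x) \<longlonglongrightarrow> indicator (U \<inter> \<Omega>) x"
      using test_functions_tendsto_indicator[of "U \<inter> \<Omega>" \<Omega>] U \<open>open \<Omega>\<close> by blast
    show ?thesis
    proof (rule dominated_by_integrable_factor[OF f _ \<phi>(2)])
      show "\<phi> n \<in> borel_measurable ?M" for n
        using \<phi>(1) \<Omega> by (intro continuous_imp_measurable_on_sets_lebesgue test_function_continuous)
      show "(\<lambda>n. \<phi> n x) \<longlonglongrightarrow> indicator U x" if "x \<in> space ?M" for x
        using \<phi>(3)[of x] that by (simp add: indicator_def)
    qed (use orth \<phi>(1) in blast)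
  qed
  have on_measurable: "(\<integral>x. f x * indicator A x \<partial>?M) = 0" if "A \<in> sets ?M" for A
  proof -
    have A: "A \<in> sets lebesgue" using that \<Omega> by (simp add: sets_restrict_space_iff)
    obtain C T where C: "gdelta C" "T \<in> null_sets lebesgue" "A \<union> T = C"
      using lebesgue_set_almost_gdelta[OF A] by metis
    from C(1) obtain G :: "nat \<Rightarrow> _" where G: "\<And>n. open (G n)" "C = \<Inter>(range G)"
      by (auto elim: gdelta.cases)
    define G' where "G' n = (\<Inter>i\<le>n. G i)" for n
    have G': "open (G' n)" for n unfolding G'_def using G(1) by (intro open_INT) auto
    have "(\<integral>x. f x * indicator C x \<partial>?M) = 0"
    proof (rule dominated_by_integrable_factor[OF f, of "\<lambda>n. indicator (G' n)"])
      show "indicator (G' n) \<in> borel_measurable ?M" for n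
        using G'[of n] by (intro measurable_restrict_space1 borel_measurable_indicator) auto
      show "(\<lambda>n. indicator (G' n) x :: real) \<longlonglongrightarrow> indicator C x" for x
      proof (cases "x \<in> C")
        case True
        then show ?thesis using G(2) by (simp add: G'_def)
      next
        case False
        then obtain j where "x \<notin> G j" using G(2) by blast
        have "\<forall>\<^sub>F n in sequentially. indicator (G' n) x = (0::real)"
          using eventually_ge_at_top[of j] by eventually_elim (use \<open>x \<notin> G j\<close> in \<open>auto simp: G'_def indicator_def\<close>)
        with False show ?thesis by (simp add: tendsto_eventually)
      qed
      show "(\<integral>x. f x * indicator (G' n) x \<partial>?M) = 0" for n
        by (rule on_open[OF G'])
    qed (simp add: indicator_def)
    moreover have "(\<integral>x. f x * indicator C x \<partial>?M) = (\<integral>x. f x * indicator A x \<partial>?M)"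
    proof (rule integral_cong_AE)
      have [measurable]: "f \<in> borel_measurable ?M" using f by auto
      have "C \<in> sets lebesgue" using C A by auto
      then have "(indicator C :: _ \<Rightarrow> real) \<in> borel_measurable ?M" "(indicator A :: _ \<Rightarrow> real) \<in> borel_measurable ?M"
        using A by (auto intro!: measurable_restrict_space1)
      then show "(\<lambda>x. f x * indicator C x) \<in> borel_measurable ?M" "(\<lambda>x. f x * indicator A x) \<in> borel_measurable ?M"
        by auto
      have "AE x in lebesgue. x \<notin> T" using C(2) by (rule AE_not_in)
      then have "AE x in ?M. x \<notin> T" using \<Omega> by (auto simp: AE_restrict_space_iff elim: eventually_mono)
      then show "AE x in ?M. f x * indicator C x = f x * indicator A x"
        by eventually_elim (use C(3) in \<open>auto simp: indicator_def\<close>)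
    qed
    ultimately show ?thesis by simp
  qed
  show ?thesis
    using density_unique_real[of ?M f "\<lambda>_. 0"] f on_measurable
    by (simp add: set_lebesgue_integral_def mult.commute)
qed

text \<open>
  The integral of \<open>\<phi> (x + h e)\<close> is independent of \<open>h\<close> by translation invariance, so all
  difference quotients have integral zero, and they converge boundedly to the partial derivative.
\<close>

lemma integral_partial_deriv_eq_0:
  fixes \<phi> :: "real^'d::finite \<Rightarrow> real"
  assumes diff: "\<And>x. \<phi> differentiable (at x)" and cont: "continuous_on UNIV (partial_deriv i \<phi>)"
    and K: "compact K" "\<And>x. x \<notin> K \<Longrightarrow> \<phi> x = 0"
  shows "integral\<^sup>L lborel (partial_deriv i \<phi>) = 0"
proof -
  let ?e = "axis i 1 :: real^'d"
  let ?\<phi>' = "partial_deriv i \<phi>"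
  obtain R where R: "\<And>x. x \<in> K \<Longrightarrow> norm x \<le> R"
    using compact_imp_bounded[OF K(1)] by (auto simp: bounded_iff)
  have out: "\<phi> x = 0" if "norm x > R" for x
    using that R[of x] K(2)[of x] by linarith
  have \<phi>_meas[measurable]: "\<phi> \<in> borel_measurable borel"
    using diff by (intro borel_measurable_continuous_onI)
      (auto simp: differentiable_imp_continuous_within continuous_on_eq_continuous_within)
  have [measurable]: "?\<phi>' \<in> borel_measurable borel"
    using cont by (intro borel_measurable_continuous_onI)
  have "continuous_on (cball 0 (R + 2)) ?\<phi>'"
    using cont continuous_on_subset by blast
  then have "bounded (?\<phi>' ` cball 0 (R + 2))"
    by (intro compact_imp_bounded compact_continuous_image) auto
  then obtain C where C: "\<And>x. norm x \<le> R + 2 \<Longrightarrow> \<bar>?\<phi>' x\<bar> \<le> C" "C > 0"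
    unfolding bounded_pos by (metis image_eqI mem_cball_0 real_norm_def)
  \<comment> \<open>Steps of length at most \<open>1\<close> keep the supports of all difference quotients in one ball.\<close>
  define h where "h n = inverse (real (Suc n))" for n
  have h: "h n > 0" "h n \<le> 1" for n by (auto simp: h_def inverse_le_1_iff)
  have along: "((\<lambda>t. \<phi> (x + t *\<^sub>R ?e)) has_real_derivative ?\<phi>' (x + t *\<^sub>R ?e)) (at t)" for x t
  proof -
    have "((\<lambda>t. \<phi> (x + t *\<^sub>R ?e)) has_derivative
        (\<lambda>s. frechet_derivative \<phi> (at (x + t *\<^sub>R ?e)) (s *\<^sub>R ?e))) (at t)"
      using diff[of "x + t *\<^sub>R ?e"] unfolding frechet_derivative_works
      by (rule has_derivative_compose[rotated]) (auto intro!: derivative_eq_intros)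
    moreover have "frechet_derivative \<phi> (at y) (s *\<^sub>R ?e) = s * ?\<phi>' y" for y s
      using linear_frechet_derivative[OF diff[of y]] by (simp add: partial_deriv_def linear_scale)
    ultimately show ?thesis
      by (simp add: has_field_derivative_def mult_commute_abs)
  qed
  define q where "q n x = (\<phi> (x + h n *\<^sub>R ?e) - \<phi> x) / h n" for n x
  have q_bound: "\<bar>q n x\<bar> \<le> C * indicator (cball 0 (R + 1)) x" for n x
  proof (cases "norm x \<le> R + 1")
    case True
    obtain z where z: "0 < z" "z < h n" "\<phi> (x + h n *\<^sub>R ?e) - \<phi> (x + 0 *\<^sub>R ?e) = (h n - 0) * ?\<phi>' (x + z *\<^sub>R ?e)"
      using MVT2[OF h(1)[of n], of "\<lambda>t. \<phi> (x + t *\<^sub>R ?e)" "\<lambda>t. ?\<phi>' (x + t *\<^sub>R ?e)"] along by blast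
    have "norm (x + z *\<^sub>R ?e) \<le> norm x + \<bar>z\<bar>"
      using norm_triangle_ineq[of x "z *\<^sub>R ?e"] by simp
    then have "\<bar>?\<phi>' (x + z *\<^sub>R ?e)\<bar> \<le> C"
      using True z h(2)[of n] by (intro C(1)) linarith
    moreover have "q n x = ?\<phi>' (x + z *\<^sub>R ?e)"
      using z(3) h(1)[of n] by (simp add: q_def)
    ultimately show ?thesis using True by simp
  next
    case False
    have "norm (h n *\<^sub>R ?e) \<le> 1" using h[of n] by simp
    then have "norm (x + h n *\<^sub>R ?e) > R" 
      using False norm_triangle_ineq4[of "x + h n *\<^sub>R ?e" "h n *\<^sub>R ?e"] by simp
    then show ?thesis using False out by (simp add: q_def)
  qed
  have "(\<lambda>n. integral\<^sup>L lborel (q n)) \<longlonglongrightarrow> integral\<^sup>L lborel ?\<phi>'"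
  proof (rule integral_dominated_convergence[where w = "\<lambda>x. C * indicator (cball 0 (R + 1)) x"])
    show "q n \<in> borel_measurable lborel" for n unfolding q_def by measurable
    show "integrable lborel (\<lambda>x::real^'d. C * indicator (cball 0 (R + 1)) x)"
      using emeasure_bounded_finite[OF bounded_cball[of "0::real^'d" "R + 1"]]
      by (intro integrable_mult_right integrable_real_indicator) auto
    show "AE x in lborel. (\<lambda>n. q n x) \<longlonglongrightarrow> ?\<phi>' x"
    proof (intro AE_I2)
      fix x
      have "h \<longlonglongrightarrow> 0" unfolding h_def by (rule LIMSEQ_inverse_real_of_nat)
      then have "filterlim h (at 0) sequentially"
        using h(1) by (simp add: filterlim_at less_imp_neq[symmetric])
      with along[of x 0] have "((\<lambda>n. (\<phi> (x + h n *\<^sub>R ?e) - \<phi> (x + 0 *\<^sub>R ?e)) / (h n - 0)) \<longlonglongrightarrow> ?\<phi>' (x + 0 *\<^sub>R ?e))"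
        unfolding has_field_derivative_iff by (rule filterlim_compose)
      then show "(\<lambda>n. q n x) \<longlonglongrightarrow> ?\<phi>' x" by (simp add: q_def)
    qed
    show "AE x in lborel. norm (q n x) \<le> C * indicator (cball 0 (R + 1)) x" for n
      using q_bound by simp
  qed auto
  moreover have "integral\<^sup>L lborel (q n) = 0" for n
  proof -
    have "continuous_on K \<phi>" 
      using diff by (auto simp: differentiable_imp_continuous_within continuous_on_eq_continuous_within
          intro: continuous_at_imp_continuous_within)
    then have "integrable lborel (\<lambda>x. indicator K x *\<^sub>R \<phi> x)"
      using K(1) by (intro borel_integrable_compact)
    moreover have "(\<lambda>x. indicator K x *\<^sub>R \<phi> x) = \<phi>"
      using K(2) by (auto simp: fun_eq_iff indicator_def)
    ultimately have int: "integrable lborel \<phi>" by simp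
    then have "integrable (distr lborel borel ((+) (h n *\<^sub>R ?e))) \<phi>"
      by (simp add: lborel_distr_plus)
    then have int': "integrable lborel (\<lambda>x. \<phi> (h n *\<^sub>R ?e + x))"
      by (subst (asm) integrable_distr_eq) auto
    have "integral\<^sup>L lborel \<phi> = integral\<^sup>L (distr lborel borel ((+) (h n *\<^sub>R ?e))) \<phi>"
      by (simp add: lborel_distr_plus)
    also have "\<dots> = (\<integral>x. \<phi> (h n *\<^sub>R ?e + x) \<partial>lborel)"
      by (subst integral_distr) auto
    finally show ?thesis using int int' by (simp add: q_def[abs_def] add.commute)
  qed
  ultimately show ?thesis by (simp add: LIMSEQ_const_iff)
qed

section \<open>The bilinear forms on bounded open sets\<close>

locale bounded_open =
  fixes \<Omega> :: "(real^'d::finite) set"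
  assumes open_\<Omega>: "open \<Omega>" and bounded_\<Omega>: "bounded \<Omega>"
begin

lemma sets_\<Omega>: "\<Omega> \<in> sets lebesgue"
  using open_\<Omega> by simp

lemma integrable_const_\<Omega>: "integrable (lebesgue_on \<Omega>) (\<lambda>x. c :: real)"
proof -
  have "\<Omega> \<in> lmeasurable" using bounded_\<Omega> open_\<Omega> by (intro lmeasurable_open)
  then interpret finite_measure "lebesgue_on \<Omega>" by (rule finite_measure_lebesgue_on)
  show ?thesis by simp
qed

lemma continuous_on_closure_measurable:
  assumes "continuous_on (closure \<Omega>) f"
  shows "f \<in> borel_measurable (lebesgue_on \<Omega>)"
  using assms sets_\<Omega> closure_subset continuous_on_subset
  by (intro continuous_imp_measurable_on_sets_lebesgue) blast+

lemma continuous_on_closure_bounded: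
  fixes f :: "real^'d \<Rightarrow> real"
  assumes "continuous_on (closure \<Omega>) f"
  obtains C where "\<And>x. x \<in> \<Omega> \<Longrightarrow> \<bar>f x\<bar> \<le> C"
proof -
  have "bounded (f ` closure \<Omega>)"
    using assms bounded_\<Omega> by (intro compact_imp_bounded compact_continuous_image) auto
  then obtain C where "\<forall>y\<in>f ` closure \<Omega>. \<bar>y\<bar> \<le> C"
    by (auto simp: bounded_iff)
  then show thesis using that closure_subset[of \<Omega>] by blast
qed

lemma L2_product_integrable:
  assumes "f \<in> L2 \<Omega>" "g \<in> L2 \<Omega>"
  shows "integrable (lebesgue_on \<Omega>) (\<lambda>x. f x * g x)"
proof (rule Bochner_Integration.integrable_bound)
  show "integrable (lebesgue_on \<Omega>) (\<lambda>x. (f x)\<^sup>2 + (g x)\<^sup>2)"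
    using assms by (auto simp: L2_def)
  show "(\<lambda>x. f x * g x) \<in> borel_measurable (lebesgue_on \<Omega>)"
    using assms by (auto simp: L2_def)
  have "\<bar>f x * g x\<bar> \<le> (f x)\<^sup>2 + (g x)\<^sup>2" for x
  proof -
    have "2 * (\<bar>f x\<bar> * \<bar>g x\<bar>) \<le> (f x)\<^sup>2 + (g x)\<^sup>2"
      using sum_squares_bound[of "\<bar>f x\<bar>" "\<bar>g x\<bar>"] by (simp add: mult.assoc)
    moreover have "0 \<le> \<bar>f x\<bar> * \<bar>g x\<bar>" by simp
    ultimately show ?thesis unfolding abs_mult by linarith
  qed
  then show "AE x in lebesgue_on \<Omega>. norm (f x * g x) \<le> norm ((f x)\<^sup>2 + (g x)\<^sup>2)"
    by (intro AE_I2) simp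
qed

lemma L2_lincomb:
  assumes "f \<in> L2 \<Omega>" "g \<in> L2 \<Omega>"
  shows "(\<lambda>x. a * f x + b * g x) \<in> L2 \<Omega>"
proof -
  have "(\<lambda>x. (a * f x + b * g x)\<^sup>2) =
      (\<lambda>x. a\<^sup>2 * (f x)\<^sup>2 + b\<^sup>2 * (g x)\<^sup>2 + 2 * a * b * (f x * g x))"
    by (auto simp: power2_eq_square algebra_simps)
  then show ?thesis
    using assms L2_product_integrable[OF assms]
    by (auto simp: L2_def)
qed

lemma L2_coeff_mult:
  assumes "continuous_on (closure \<Omega>) a" "f \<in> L2 \<Omega>"
  shows "(\<lambda>x. a x * f x) \<in> L2 \<Omega>"
proof -
  obtain C where C: "\<And>x. x \<in> \<Omega> \<Longrightarrow> \<bar>a x\<bar> \<le> C"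
    using continuous_on_closure_bounded[OF assms(1)] by blast
  have m: "(\<lambda>x. a x * f x) \<in> borel_measurable (lebesgue_on \<Omega>)"
    using continuous_on_closure_measurable[OF assms(1)] assms(2) by (auto simp: L2_def)
  have "integrable (lebesgue_on \<Omega>) (\<lambda>x. (a x * f x)\<^sup>2)"
  proof (rule Bochner_Integration.integrable_bound)
    show "integrable (lebesgue_on \<Omega>) (\<lambda>x. C\<^sup>2 * (f x)\<^sup>2)"
      using assms(2) by (auto simp: L2_def)
    show "(\<lambda>x. (a x * f x)\<^sup>2) \<in> borel_measurable (lebesgue_on \<Omega>)"
      using m by auto
    have "(a x)\<^sup>2 \<le> C\<^sup>2" if "x \<in> \<Omega>" for x
      using C[OF that] by (metis abs_ge_zero power2_abs power_mono)
    then show "AE x in lebesgue_on \<Omega>. norm ((a x * f x)\<^sup>2) \<le> norm (C\<^sup>2 * (f x)\<^sup>2)"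
      by (intro AE_I2) (auto simp: power_mult_distrib intro: mult_right_mono)
  qed
  with m show ?thesis by (simp add: L2_def)
qed

lemma continuous_on_closure_L2:
  assumes "continuous_on (closure \<Omega>) f"
  shows "f \<in> L2 \<Omega>"
proof -
  have "(\<lambda>x. 1) \<in> L2 \<Omega>" using integrable_const_\<Omega>[of 1] by (simp add: L2_def)
  from L2_coeff_mult[OF assms this] show ?thesis by simp
qed

lemma L2_inner_sym: "L2_inner \<Omega> f g = L2_inner \<Omega> g f"
  by (simp add: L2_inner_def mult.commute)

lemma L2_inner_lincomb_left:
  assumes "f \<in> L2 \<Omega>" "g \<in> L2 \<Omega>" "h \<in> L2 \<Omega>"
  shows "L2_inner \<Omega> (\<lambda>x. a * f x + b * g x) h = a * L2_inner \<Omega> f h + b * L2_inner \<Omega> g h"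
proof -
  have "L2_inner \<Omega> (\<lambda>x. a * f x + b * g x) h =
      (\<integral>x. a * (f x * h x) + b * (g x * h x) \<partial>lebesgue_on \<Omega>)"
    unfolding L2_inner_def by (intro Bochner_Integration.integral_cong) (auto simp: algebra_simps)
  also have "\<dots> = a * L2_inner \<Omega> f h + b * L2_inner \<Omega> g h"
    using L2_product_integrable[OF assms(1,3)] L2_product_integrable[OF assms(2,3)]
    by (simp add: L2_inner_def)
  finally show ?thesis .
qed

lemma L2_inner_lincomb_right:
  assumes "f \<in> L2 \<Omega>" "g \<in> L2 \<Omega>" "h \<in> L2 \<Omega>"
  shows "L2_inner \<Omega> h (\<lambda>x. a * f x + b * g x) = a * L2_inner \<Omega> h f + b * L2_inner \<Omega> h g"
  using L2_inner_lincomb_left[OF assms] by (simp add: L2_inner_sym)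

lemma L2_inner_nonneg: "L2_inner \<Omega> f f \<ge> 0"
  by (simp add: L2_inner_def)

lemma L2_norm_square: "(L2_norm \<Omega> f)\<^sup>2 = L2_inner \<Omega> f f"
  by (simp add: L2_norm_def L2_inner_nonneg)

text \<open>
  A continuous function that vanishes almost everywhere on an open set vanishes there, and hence on
  its closure.
\<close>

lemma L2_inner_definite:
  assumes cont: "continuous_on (closure \<Omega>) f" and zero: "L2_inner \<Omega> f f = 0"
    and x: "x \<in> closure \<Omega>"
  shows "f x = 0"
proof -
  have f: "f \<in> L2 \<Omega>" using cont by (rule continuous_on_closure_L2)
  have "AE x in lebesgue_on \<Omega>. f x * f x = 0"
    using zero L2_product_integrable[OF f f]
    by (subst (asm) L2_inner_def, subst (asm) integral_nonneg_eq_0_iff_AE) auto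
  then have ae: "AE x \<in> \<Omega> in lebesgue. x \<in> {x \<in> closure \<Omega>. f x = 0}"
    using sets_\<Omega> closure_subset[of \<Omega>] by (auto simp: AE_restrict_space_iff elim: eventually_mono)
  have "closed (closure \<Omega> \<inter> f -` {0})"
    using cont by (intro continuous_closed_preimage) auto
  then have "closed {x \<in> closure \<Omega>. f x = 0}"
    by (simp add: vimage_def Int_def)
  then have "f x = 0" if "x \<in> \<Omega>" for x
    using mem_closed_if_AE_lebesgue_open[OF open_\<Omega> _ ae that] by blast
  from continuous_constant_on_closure[OF cont this x] show ?thesis .
qed

lemma test_function_L2:
  assumes "\<phi> \<in> test_functions \<Omega>"
  shows "\<phi> \<in> L2 \<Omega>" "partial_deriv i \<phi> \<in> L2 \<Omega>"
proof -
  show "\<phi> \<in> L2 \<Omega>"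
    using assms by (intro continuous_on_closure_L2 test_function_continuous)
  have "C_times (Suc 0) \<phi>" using assms by (simp only: test_functions_def mem_Collect_eq)
  then have "continuous_on UNIV (partial_deriv i \<phi>)" by simp
  then show "partial_deriv i \<phi> \<in> L2 \<Omega>"
    by (intro continuous_on_closure_L2) (auto intro: continuous_on_subset)
qed

lemma is_weak_grad_lincomb:
  assumes "v \<in> L2 \<Omega>" "is_weak_grad \<Omega> v g" "w \<in> L2 \<Omega>" "is_weak_grad \<Omega> w h"
  shows "is_weak_grad \<Omega> (\<lambda>x. a * v x + b * w x) (\<lambda>x. a *\<^sub>R g x + b *\<^sub>R h x)"
  using assms test_function_L2
  by (auto simp: is_weak_grad_def L2_lincomb L2_inner_lincomb_left algebra_simps)

text \<open>
  This makes \<open>weak_grad\<close>, which picks some weak gradient, a linear operator up to null sets, so that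
  \<open>A_form\<close> is bilinear.
\<close>

lemma is_weak_grad_AE_unique:
  assumes "is_weak_grad \<Omega> v g" "is_weak_grad \<Omega> v h"
  shows "AE x in lebesgue_on \<Omega>. g x = h x"
proof -
  have "AE x in lebesgue_on \<Omega>. g x $ i - h x $ i = 0" for i
  proof (rule fundamental_lemma_calculus_of_variations[OF open_\<Omega>])
    have gh: "(\<lambda>x. g x $ i) \<in> L2 \<Omega>" "(\<lambda>x. h x $ i) \<in> L2 \<Omega>"
      using assms by (auto simp: is_weak_grad_def)
    have diff: "(\<lambda>x. g x $ i - h x $ i) \<in> L2 \<Omega>"
      using L2_lincomb[OF gh, of 1 "-1"] by simp
    have one: "(\<lambda>x. 1) \<in> L2 \<Omega>" by (intro continuous_on_closure_L2) auto
    show "integrable (lebesgue_on \<Omega>) (\<lambda>x. g x $ i - h x $ i)"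
      using L2_product_integrable[OF diff one] by simp
    fix \<phi> assume \<phi>: "\<phi> \<in> test_functions \<Omega>"
    have "L2_inner \<Omega> (\<lambda>x. g x $ i) \<phi> = L2_inner \<Omega> (\<lambda>x. h x $ i) \<phi>"
      using assms \<phi> unfolding is_weak_grad_def by (metis neg_equal_iff_equal)
    then show "(\<integral>x. (g x $ i - h x $ i) * \<phi> x \<partial>lebesgue_on \<Omega>) = 0"
      using L2_inner_lincomb_left[OF gh test_function_L2(1)[OF \<phi>], of 1 "-1"]
      by (simp add: L2_inner_def)
  qed
  then have "AE x in lebesgue_on \<Omega>. \<forall>i\<in>UNIV. g x $ i - h x $ i = 0"
    by (intro AE_finite_allI) auto
  then show ?thesis by eventually_elim (simp add: vec_eq_iff)
qed

lemma H1_imp_L2: "v \<in> H1 \<Omega> \<Longrightarrow> v \<in> L2 \<Omega>"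
  by (simp add: H1_def)

lemma is_weak_grad_weak_grad: "v \<in> H1 \<Omega> \<Longrightarrow> is_weak_grad \<Omega> v (weak_grad \<Omega> v)"
  unfolding weak_grad_def H1_def by (auto intro: someI[where P = "is_weak_grad \<Omega> v"])

lemma H1_lincomb: "v \<in> H1 \<Omega> \<Longrightarrow> w \<in> H1 \<Omega> \<Longrightarrow> (\<lambda>x. a * v x + b * w x) \<in> H1 \<Omega>"
  using is_weak_grad_lincomb L2_lincomb unfolding H1_def by blast

lemma weak_grad_lincomb:
  assumes "v \<in> H1 \<Omega>" "w \<in> H1 \<Omega>"
  shows "AE x in lebesgue_on \<Omega>. weak_grad \<Omega> (\<lambda>x. a * v x + b * w x) x =
    a *\<^sub>R weak_grad \<Omega> v x + b *\<^sub>R weak_grad \<Omega> w x"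
  using assms
  by (intro is_weak_grad_AE_unique[OF is_weak_grad_weak_grad is_weak_grad_lincomb]
      H1_lincomb H1_imp_L2 is_weak_grad_weak_grad)

text \<open>
  Needed for mass conservation, where the test function is constant on \<open>\<Omega>\<close> but not on the whole
  space; compact support of \<open>\<phi>\<close> in \<open>\<Omega>\<close> allows its derivative to be integrated over the whole
  space instead.
\<close>

lemma is_weak_grad_const:
  assumes "\<And>x. x \<in> \<Omega> \<Longrightarrow> v x = c"
  shows "is_weak_grad \<Omega> v (\<lambda>x. 0)"
  unfolding is_weak_grad_def
proof (intro allI conjI ballI)
  fix i
  show "(\<lambda>x. (0::real^'d) $ i) \<in> L2 \<Omega>" by (simp add: L2_def)
  fix \<phi> assume \<phi>: "\<phi> \<in> test_functions \<Omega>"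
  then obtain K where K: "compact K" "K \<subseteq> \<Omega>" "\<And>x. x \<notin> K \<Longrightarrow> \<phi> x = 0"
    by (auto simp: test_functions_def)
  have "C_times (Suc 0) \<phi>" using \<phi> by (simp only: test_functions_def mem_Collect_eq)
  then have diff: "\<And>x. \<phi> differentiable (at x)" and cont: "continuous_on UNIV (partial_deriv i \<phi>)"
    by simp_all
  have zero: "partial_deriv i \<phi> x = 0" if "x \<notin> K" for x
  proof -
    have "open (- K)" using K(1) compact_imp_closed by blast
    have "((\<lambda>x. 0 :: real) has_derivative (\<lambda>h. 0)) (at x)" by simp
    then have "(\<phi> has_derivative (\<lambda>h. 0)) (at x)"
      by (rule has_derivative_transform_within_open[OF _ \<open>open (- K)\<close>]) (use K(3) that in auto)
    from partial_deriv_eqI[OF this] show ?thesis .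
  qed
  have "L2_inner \<Omega> v (partial_deriv i \<phi>) = (\<integral>x. c * partial_deriv i \<phi> x \<partial>lebesgue_on \<Omega>)"
    unfolding L2_inner_def using assms by (intro Bochner_Integration.integral_cong) auto
  also have "\<dots> = c * integral\<^sup>L lebesgue (\<lambda>x. if x \<in> \<Omega> then partial_deriv i \<phi> x else 0)"
    by (simp add: Lebesgue_Measure.integral_restrict_UNIV sets_\<Omega>)
  also have "(\<lambda>x. if x \<in> \<Omega> then partial_deriv i \<phi> x else 0) = partial_deriv i \<phi>"
    using zero K(2) by (intro ext) (auto dest: subsetD)
  also have "integral\<^sup>L lebesgue (partial_deriv i \<phi>) = integral\<^sup>L lborel (partial_deriv i \<phi>)"
    using cont by (intro integral_completion) (auto intro: borel_measurable_continuous_onI)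
  also have "\<dots> = 0"
    using diff cont K(1,3) by (rule integral_partial_deriv_eq_0)
  finally show "L2_inner \<Omega> v (partial_deriv i \<phi>) = - L2_inner \<Omega> (\<lambda>x. (0::real^'d) $ i) \<phi>"
    by (simp add: L2_inner_def)
qed

lemma weak_grad_component_L2: "v \<in> H1 \<Omega> \<Longrightarrow> (\<lambda>x. weak_grad \<Omega> v x $ i) \<in> L2 \<Omega>"
  using is_weak_grad_weak_grad by (auto simp: is_weak_grad_def)

lemma A_form_integrable:
  assumes "continuous_on (closure \<Omega>) a" "q \<in> H1 \<Omega>" "v \<in> H1 \<Omega>"
  shows "integrable (lebesgue_on \<Omega>) (\<lambda>x. a x * (weak_grad \<Omega> q x \<bullet> weak_grad \<Omega> v x))"
proof -
  have "integrable (lebesgue_on \<Omega>) (\<lambda>x. \<Sum>i\<in>UNIV. (a x * weak_grad \<Omega> q x $ i) * weak_grad \<Omega> v x $ i)"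
    using assms
    by (intro Bochner_Integration.integrable_sum L2_product_integrable L2_coeff_mult weak_grad_component_L2)
  then show ?thesis by (simp add: inner_vec_def sum_distrib_left mult.assoc)
qed

lemma A_form_sym: "A_form \<Omega> a q v = A_form \<Omega> a v q"
  by (simp add: A_form_def inner_commute)

lemma A_form_lincomb_left:
  assumes "continuous_on (closure \<Omega>) a" "q \<in> H1 \<Omega>" "r \<in> H1 \<Omega>" "v \<in> H1 \<Omega>"
  shows "A_form \<Omega> a (\<lambda>x. \<alpha> * q x + \<beta> * r x) v = \<alpha> * A_form \<Omega> a q v + \<beta> * A_form \<Omega> a r v"
proof -
  note q = A_form_integrable[OF assms(1,2,4)]
  note r = A_form_integrable[OF assms(1,3,4)]
  note qr = A_form_integrable[OF assms(1) H1_lincomb[OF assms(2,3)] assms(4)]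
  have "A_form \<Omega> a (\<lambda>x. \<alpha> * q x + \<beta> * r x) v =
      (\<integral>x. \<alpha> * (a x * (weak_grad \<Omega> q x \<bullet> weak_grad \<Omega> v x))
         + \<beta> * (a x * (weak_grad \<Omega> r x \<bullet> weak_grad \<Omega> v x)) \<partial>lebesgue_on \<Omega>)"
    unfolding A_form_def
  proof (rule integral_cong_AE)
    show "AE x in lebesgue_on \<Omega>.
        a x * (weak_grad \<Omega> (\<lambda>x. \<alpha> * q x + \<beta> * r x) x \<bullet> weak_grad \<Omega> v x) =
        \<alpha> * (a x * (weak_grad \<Omega> q x \<bullet> weak_grad \<Omega> v x)) +
        \<beta> * (a x * (weak_grad \<Omega> r x \<bullet> weak_grad \<Omega> v x))"
      using weak_grad_lincomb[OF assms(2,3), of \<alpha> \<beta>]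
      by eventually_elim (simp add: inner_add_left algebra_simps)
  qed (use q r qr in auto)
  also have "\<dots> = \<alpha> * A_form \<Omega> a q v + \<beta> * A_form \<Omega> a r v"
    using q r by (simp add: A_form_def)
  finally show ?thesis .
qed

lemma A_form_lincomb_right:
  assumes "continuous_on (closure \<Omega>) a" "q \<in> H1 \<Omega>" "r \<in> H1 \<Omega>" "v \<in> H1 \<Omega>"
  shows "A_form \<Omega> a v (\<lambda>x. \<alpha> * q x + \<beta> * r x) = \<alpha> * A_form \<Omega> a v q + \<beta> * A_form \<Omega> a v r"
  using A_form_lincomb_left[OF assms] by (simp add: A_form_sym)

lemma A_form_const_right:
  assumes "continuous_on (closure \<Omega>) a" "q \<in> H1 \<Omega>" "v \<in> H1 \<Omega>" "\<And>x. x \<in> \<Omega> \<Longrightarrow> v x = c"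
  shows "A_form \<Omega> a q v = 0"
proof -
  have "AE x in lebesgue_on \<Omega>. weak_grad \<Omega> v x = 0"
    by (rule is_weak_grad_AE_unique[OF is_weak_grad_weak_grad[OF assms(3)] is_weak_grad_const[OF assms(4)]])
  then have "AE x in lebesgue_on \<Omega>. a x * (weak_grad \<Omega> q x \<bullet> weak_grad \<Omega> v x) = 0"
    by eventually_elim simp
  then show ?thesis by (simp add: A_form_def integral_eq_zero_AE)
qed

lemma A_form_nonneg:
  assumes "\<And>x. x \<in> \<Omega> \<Longrightarrow> a x \<ge> 0"
  shows "A_form \<Omega> a q q \<ge> 0"
  unfolding A_form_def using assms by (intro integral_nonneg_AE AE_I2) auto

text \<open>
  With a nonnegative coefficient that may vanish, \<open>A\<close> is only a seminorm squared. If it is zero at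
  \<open>q\<close>, then at almost every point the coefficient or the gradient of \<open>q\<close> is zero, so that the form
  also vanishes against every other function.
\<close>

lemma A_form_degenerate:
  assumes a: "continuous_on (closure \<Omega>) a" "\<And>x. x \<in> \<Omega> \<Longrightarrow> a x \<ge> 0"
    and q: "q \<in> H1 \<Omega>" "A_form \<Omega> a q q = 0"
  shows "A_form \<Omega> a q v = 0"
proof -
  have "AE x in lebesgue_on \<Omega>. a x * (weak_grad \<Omega> q x \<bullet> weak_grad \<Omega> q x) = 0"
    using q(2) A_form_integrable[OF a(1) q(1) q(1)] a(2)
    by (subst (asm) A_form_def, subst (asm) integral_nonneg_eq_0_iff_AE) auto
  then have "AE x in lebesgue_on \<Omega>. a x * (weak_grad \<Omega> q x \<bullet> weak_grad \<Omega> v x) = 0"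
    by eventually_elim auto
  then show ?thesis by (simp add: A_form_def integral_eq_zero_AE)
qed

end

section \<open>Square linear systems on finite-dimensional function spaces\<close>

text \<open>
  Gaussian elimination: the unknown \<open>p\<close> is eliminated with the help of the equation \<open>i\<close>.
\<close>

lemma underdetermined_system:
  fixes A :: "'e \<Rightarrow> 'j \<Rightarrow> real"
  assumes "finite E" "finite J" "card E < card J"
  shows "\<exists>c. (\<exists>j\<in>J. c j \<noteq> 0) \<and> (\<forall>i\<in>E. (\<Sum>j\<in>J. c j * A i j) = 0)"
  using assms
proof (induction E arbitrary: J A rule: finite_induct)
  case empty
  then have "J \<noteq> {}" by auto
  then show ?case by (intro exI[of _ "\<lambda>_. 1"]) auto
next
  case (insert i E)
  show ?case
  proof (cases "\<forall>j\<in>J. A i j = 0")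
    case True
    then show ?thesis using insert by force
  next
    case False
    then obtain p where p: "p \<in> J" "A i p \<noteq> 0" by blast
    define J' where "J' = J - {p}"
    have J': "finite J'" "card E < card J'" "p \<notin> J'" "J = insert p J'"
      using insert p by (auto simp: J'_def)
    define A' where "A' k j = A k j - A k p * A i j / A i p" for k j
    obtain c where c: "\<exists>j\<in>J'. c j \<noteq> 0" "\<And>k. k \<in> E \<Longrightarrow> (\<Sum>j\<in>J'. c j * A' k j) = 0"
      using insert.IH[OF J'(1,2), of A'] by blast
    define S where "S = (\<Sum>j\<in>J'. c j * A i j)"
    define d where "d = c(p := - S / A i p)"
    have split: "(\<Sum>j\<in>J. d j * A k j) = - S / A i p * A k p + (\<Sum>j\<in>J'. c j * A k j)" for k
      unfolding J'(4) using J'(1,3) by (subst sum.insert) (auto simp: d_def intro!: sum.cong)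
    have "(\<Sum>j\<in>J. d j * A k j) = 0" if "k \<in> insert i E" for k
    proof (cases "k = i")
      case True
      then show ?thesis using split[of i] p(2) by (simp add: S_def)
    next
      case False
      then have "(\<Sum>j\<in>J'. c j * A' k j) = 0" using that c(2) by blast
      then have "(\<Sum>j\<in>J'. c j * A k j) = (\<Sum>j\<in>J'. A k p / A i p * (c j * A i j))"
        by (simp add: A'_def algebra_simps sum_subtractf)
      also have "\<dots> = A k p / A i p * S"
        unfolding S_def by (simp only: sum_distrib_left)
      finally show ?thesis by (simp add: split)
    qed
    moreover have "\<exists>j\<in>J. d j \<noteq> 0"
      using c(1) J'(3,4) by (auto simp: d_def)
    ultimately show ?thesis by blast
  qed
qed

definition function_space :: "('x \<Rightarrow> real) set \<Rightarrow> bool" where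
  "function_space V \<longleftrightarrow> (\<lambda>_. 0) \<in> V \<and> (\<forall>u\<in>V. \<forall>v\<in>V. \<forall>a b. (\<lambda>x. a * u x + b * v x) \<in> V)"

text \<open>
  The generators need not belong to \<open>V\<close>. This allows piecewise monomials, which are discontinuous,
  as generators of a space of continuous functions.
\<close>

definition finitely_generated :: "('x \<Rightarrow> real) set \<Rightarrow> bool" where
  "finitely_generated V \<longleftrightarrow>
     (\<exists>n e. \<forall>v\<in>V. \<exists>c. \<forall>x. v x = (\<Sum>k<(n::nat). c k * e k x))"

definition linear_on_space :: "('x \<Rightarrow> real) set \<Rightarrow> (('x \<Rightarrow> real) \<Rightarrow> real) \<Rightarrow> bool" where
  "linear_on_space V L \<longleftrightarrow>
     (\<forall>u\<in>V. \<forall>v\<in>V. \<forall>a b. L (\<lambda>x. a * u x + b * v x) = a * L u + b * L v)"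

lemma finitely_generatedI:
  assumes "finite K" "\<And>v. v \<in> V \<Longrightarrow> \<exists>c. \<forall>x. v x = (\<Sum>k\<in>K. c k * e k x)"
  shows "finitely_generated V"
proof -
  obtain h where h: "bij_betw h {..<card K} K"
    using ex_bij_betw_nat_finite[OF assms(1)] by (auto simp: atLeast0LessThan)
  show ?thesis
    unfolding finitely_generated_def
  proof (rule exI[of _ "card K"], rule exI[of _ "e \<circ> h"], rule ballI)
    fix v assume "v \<in> V"
    then obtain c where "\<And>x. v x = (\<Sum>k\<in>K. c k * e k x)" using assms(2) by blast
    then have "\<forall>x. v x = (\<Sum>k<card K. (c \<circ> h) k * (e \<circ> h) k x)"
      using sum.reindex_bij_betw[OF h, of "\<lambda>k. c k * e k x" for x] by (simp add: o_def)
    then show "\<exists>c. \<forall>x. v x = (\<Sum>k<card K. c k * (e \<circ> h) k x)" by blast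
  qed
qed

lemma function_space_lincomb:
  "function_space V \<Longrightarrow> u \<in> V \<Longrightarrow> v \<in> V \<Longrightarrow> (\<lambda>x. a * u x + b * v x) \<in> V"
  by (simp add: function_space_def)

lemma function_space_scale:
  assumes "function_space V" "u \<in> V" shows "(\<lambda>x. a * u x) \<in> V"
  using function_space_lincomb[OF assms assms(2), of a 0] by simp

lemma function_space_sum:
  assumes "function_space V" "\<And>j. j < m \<Longrightarrow> e j \<in> V"
  shows "(\<lambda>x. \<Sum>j<(m::nat). c j * e j x) \<in> V"
  using assms(2)
proof (induction m)
  case 0
  then show ?case using assms(1) by (simp add: function_space_def)
next
  case (Suc m)
  then have "(\<lambda>x. 1 * (\<Sum>j<m. c j * e j x) + c m * e m x) \<in> V"
    by (intro function_space_lincomb[OF assms(1)]) auto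
  then show ?case by simp
qed

lemma linear_on_space_lincomb:
  "linear_on_space V L \<Longrightarrow> u \<in> V \<Longrightarrow> v \<in> V \<Longrightarrow> L (\<lambda>x. a * u x + b * v x) = a * L u + b * L v"
  by (simp add: linear_on_space_def)

lemma linear_on_space_scale:
  assumes "linear_on_space V L" "u \<in> V" shows "L (\<lambda>x. a * u x) = a * L u"
  using linear_on_space_lincomb[OF assms assms(2), of a 0] by simp

lemma linear_on_space_sum:
  assumes "function_space V" "linear_on_space V L" "\<And>j. j < m \<Longrightarrow> e j \<in> V"
  shows "L (\<lambda>x. \<Sum>j<(m::nat). c j * e j x) = (\<Sum>j<m. c j * L (e j))"
  using assms(3)
proof (induction m)
  case 0
  have "(\<lambda>_. 0) \<in> V" using assms(1) by (simp add: function_space_def)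
  from linear_on_space_scale[OF assms(2) this, of 0] show ?case by simp
next
  case (Suc m)
  have "L (\<lambda>x. 1 * (\<Sum>j<m. c j * e j x) + c m * e m x) =
      1 * L (\<lambda>x. \<Sum>j<m. c j * e j x) + c m * L (e m)"
    using Suc.prems
    by (intro linear_on_space_lincomb[OF assms(2)] function_space_sum[OF assms(1)]) auto
  with Suc show ?case by simp
qed

definition independent_family :: "nat \<Rightarrow> (nat \<Rightarrow> 'x \<Rightarrow> real) \<Rightarrow> bool" where
  "independent_family m e \<longleftrightarrow>
     (\<forall>c. (\<forall>x. (\<Sum>j<m. c j * e j x) = 0) \<longrightarrow> (\<forall>j<m. c j = 0))"

text \<open>
  Independent families in \<open>V\<close> cannot be longer than the list of generators, since otherwise the
  coefficient vectors would be dependent by \<open>underdetermined_system\<close>. A longest one spans \<open>V\<close>.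
\<close>

lemma finite_basis:
  assumes V: "function_space V" "finitely_generated V"
  obtains m :: nat and e where "\<And>j. j < m \<Longrightarrow> e j \<in> V" "independent_family m e"
    "\<And>v. v \<in> V \<Longrightarrow> \<exists>c. v = (\<lambda>x. \<Sum>j<m. c j * e j x)"
proof -
  obtain n g where g: "\<And>v. v \<in> V \<Longrightarrow> \<exists>c. \<forall>x. v x = (\<Sum>k<(n::nat). c k * g k x)"
    using V(2) unfolding finitely_generated_def by blast
  define P where "P m \<longleftrightarrow> (\<exists>e. (\<forall>j<m. e j \<in> V) \<and> independent_family m e)" for m
  have bound: "m \<le> n" if "P m" for m
  proof (rule ccontr)
    assume "\<not> m \<le> n"
    obtain e where e: "\<And>j. j < m \<Longrightarrow> e j \<in> V" "independent_family m e"
      using \<open>P m\<close> unfolding P_def by blast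
    have "\<forall>j\<in>{..<m}. \<exists>c. \<forall>x. e j x = (\<Sum>k<n. c k * g k x)"
      using e(1) g by simp
    from bchoice[OF this]
    obtain A where A: "\<And>j x. j < m \<Longrightarrow> e j x = (\<Sum>k<n. A j k * g k x)"
      by auto
    obtain c where c: "\<exists>j<m. c j \<noteq> 0" "\<And>k. k < n \<Longrightarrow> (\<Sum>j<m. c j * A j k) = 0"
      using underdetermined_system[of "{..<n}" "{..<m}" "\<lambda>k j. A j k"] \<open>\<not> m \<le> n\<close> by auto
    have "(\<Sum>j<m. c j * e j x) = 0" for x
    proof -
      have "(\<Sum>j<m. c j * e j x) = (\<Sum>j<m. \<Sum>k<n. c j * A j k * g k x)"
        by (simp add: A sum_distrib_left mult.assoc)
      also have "\<dots> = (\<Sum>k<n. (\<Sum>j<m. c j * A j k) * g k x)"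
        by (subst sum.swap) (simp add: sum_distrib_right)
      also have "\<dots> = 0" using c(2) by simp
      finally show ?thesis .
    qed
    then show False using e(2) c(1) unfolding independent_family_def by blast
  qed
  have "P 0" by (simp add: P_def independent_family_def)
  then obtain m where m: "P m" "\<And>k. P k \<Longrightarrow> k \<le> m"
    using Greatest_le_nat[of P _ n] GreatestI_nat[of P 0 n] bound by blast
  from m(1) obtain e where e: "\<And>j. j < m \<Longrightarrow> e j \<in> V" "independent_family m e"
    unfolding P_def by blast
  have "\<exists>c. v = (\<lambda>x. \<Sum>j<m. c j * e j x)" if "v \<in> V" for v
  proof -
    have "\<not> P (Suc m)" using m(2) by fastforce
    moreover have "\<forall>j<Suc m. (e(m := v)) j \<in> V" using e(1) that by (simp add: less_Suc_eq)
    ultimately have "\<not> independent_family (Suc m) (e(m := v))"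
      unfolding P_def by blast
    then obtain c where c: "\<And>x. (\<Sum>j<Suc m. c j * (e(m := v)) j x) = 0" "\<exists>j<Suc m. c j \<noteq> 0"
      unfolding independent_family_def by blast
    have eq: "(\<Sum>j<m. c j * e j x) + c m * v x = 0" for x
      using c(1)[of x] by simp
    have "c m \<noteq> 0"
    proof
      assume "c m = 0"
      with eq e(2) have "\<forall>j<m. c j = 0" by (simp add: independent_family_def)
      with c(2) \<open>c m = 0\<close> show False by (auto simp: less_Suc_eq)
    qed
    have "v x = (\<Sum>j<m. (- c j / c m) * e j x)" for x
    proof -
      have "(\<Sum>j<m. (- c j / c m) * e j x) = (- 1 / c m) * (\<Sum>j<m. c j * e j x)"
        by (simp add: sum_distrib_left)
      also have "\<dots> = v x" using eq[of x] \<open>c m \<noteq> 0\<close> by (simp add: field_simps)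
      finally show ?thesis by simp
    qed
    then have "v = (\<lambda>x. \<Sum>j<m. (- c j / c m) * e j x)" by (rule ext)
    then show ?thesis by (intro exI[of _ "\<lambda>j. - c j / c m"])
  qed
  with e show ?thesis using that by blast
qed

text \<open>
  The equations \<open>\<Sum>j c\<^sub>j b(e\<^sub>j, e\<^sub>i) = c\<^sub>m l(e\<^sub>i)\<close> for \<open>i < m\<close> have one more unknown than
  equations, so there is a nontrivial solution. Nondegeneracy excludes \<open>c\<^sub>m = 0\<close>, and division by
  \<open>c\<^sub>m\<close> yields the solution of the inhomogeneous system.
\<close>

theorem nondegenerate_form_solvable:
  assumes V: "function_space V" "finitely_generated V"
    and b_left: "\<And>t. t \<in> V \<Longrightarrow> linear_on_space V (\<lambda>u. b u t)"
    and b_right: "\<And>u. u \<in> V \<Longrightarrow> linear_on_space V (b u)"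
    and l: "linear_on_space V l"
    and nondeg: "\<And>u. u \<in> V \<Longrightarrow> (\<And>t. t \<in> V \<Longrightarrow> b u t = 0) \<Longrightarrow> u = (\<lambda>_. 0)"
  shows "\<exists>!u. u \<in> V \<and> (\<forall>t\<in>V. b u t = l t)"
proof (rule ex_ex1I)
  obtain m :: nat and e where e: "\<And>j. j < m \<Longrightarrow> e j \<in> V" "independent_family m e"
    "\<And>v. v \<in> V \<Longrightarrow> \<exists>c. v = (\<lambda>x. \<Sum>j<m. c j * e j x)"
    using finite_basis[OF V] by blast
  define A where "A i j = (if j < m then b (e j) (e i) else - l (e i))" for i j
  obtain c where c: "\<exists>j<Suc m. c j \<noteq> 0" "\<And>i. i < m \<Longrightarrow> (\<Sum>j<Suc m. c j * A i j) = 0"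
    using underdetermined_system[of "{..<m}" "{..<Suc m}" A] by auto
  define u where "u = (\<lambda>x. \<Sum>j<m. c j * e j x)"
  have u: "u \<in> V" unfolding u_def using e(1) by (intro function_space_sum[OF V(1)])
  have on_basis: "b u (e i) = c m * l (e i)" if "i < m" for i
    using linear_on_space_sum[OF V(1) b_left[OF e(1)[OF that]] e(1), where c = c] c(2)[OF that]
    by (simp add: u_def A_def)
  have all: "b u t = c m * l t" if "t \<in> V" for t
  proof -
    from e(3)[OF that]
    obtain d where t: "t = (\<lambda>x. \<Sum>j<m. d j * e j x)" by (elim exE)
    have "b u t = (\<Sum>j<m. d j * b u (e j))"
      unfolding t using e(1) by (intro linear_on_space_sum[OF V(1) b_right[OF u]])
    moreover have "l t = (\<Sum>j<m. d j * l (e j))"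
      unfolding t using e(1) by (intro linear_on_space_sum[OF V(1) l])
    ultimately show ?thesis
      by (simp add: on_basis sum_distrib_left mult.left_commute)
  qed
  have "c m \<noteq> 0"
  proof
    assume "c m = 0"
    then have "u = (\<lambda>_. 0)" using nondeg[OF u] all by simp
    then have "\<forall>j<m. c j = 0" using e(2) unfolding independent_family_def u_def fun_eq_iff by blast
    with c(1) \<open>c m = 0\<close> show False by (auto simp: less_Suc_eq)
  qed
  show "\<exists>u. u \<in> V \<and> (\<forall>t\<in>V. b u t = l t)"
  proof (intro exI conjI ballI)
    show "(\<lambda>x. (1 / c m) * u x) \<in> V" using V(1) u by (rule function_space_scale)
    show "b (\<lambda>x. (1 / c m) * u x) t = l t" if "t \<in> V" for t
      unfolding linear_on_space_scale[OF b_left[OF that] u] all[OF that]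
      using \<open>c m \<noteq> 0\<close> by simp
  qed
next
  fix u v assume u: "u \<in> V \<and> (\<forall>t\<in>V. b u t = l t)" and v: "v \<in> V \<and> (\<forall>t\<in>V. b v t = l t)"
  have "(\<lambda>x. 1 * u x + (-1) * v x) = (\<lambda>_. 0)"
  proof (rule nondeg)
    show "(\<lambda>x. 1 * u x + (-1) * v x) \<in> V"
      using u v by (intro function_space_lincomb[OF V(1)]) auto
    show "b (\<lambda>x. 1 * u x + (-1) * v x) t = 0" if "t \<in> V" for t
      using linear_on_space_lincomb[OF b_left[OF that], of u v 1 "-1"] u v that by simp
  qed
  then show "u = v" by (auto simp: fun_eq_iff)
qed

text \<open>
  Pairs of functions are encoded as functions on the disjoint sum, so that systems of equations for
  several unknown functions are covered by the results for one function space.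
\<close>

definition product_space :: "('x \<Rightarrow> real) set \<Rightarrow> ('y \<Rightarrow> real) set \<Rightarrow> ('x + 'y \<Rightarrow> real) set" where
  "product_space V W = {case_sum v w | v w. v \<in> V \<and> w \<in> W}"

lemma case_sum_lincomb:
  "(\<lambda>x. a * case_sum v w x + b * case_sum v' w' x) =
     case_sum (\<lambda>x. a * v x + b * v' x) (\<lambda>x. a * w x + b * w' x)"
  by (auto simp: fun_eq_iff split: sum.split)

lemma case_sum_0: "case_sum (\<lambda>_. 0) (\<lambda>_. 0) = (\<lambda>_. 0)"
  by (auto simp: fun_eq_iff split: sum.split)

lemma case_sum_inject: "case_sum v w = case_sum v' w' \<longleftrightarrow> v = v' \<and> w = w'"
  by (metis case_sum_o_inj)

lemma product_space_iff [simp]: "case_sum v w \<in> product_space V W \<longleftrightarrow> v \<in> V \<and> w \<in> W"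
  by (auto simp: product_space_def case_sum_inject)

lemma function_space_product:
  assumes "function_space V" "function_space W"
  shows "function_space (product_space V W)"
proof -
  have "(\<lambda>_. 0) \<in> product_space V W"
    using assms product_space_iff[of "\<lambda>_. 0" "\<lambda>_. 0" V W]
    by (simp add: function_space_def case_sum_0)
  moreover have "(\<lambda>x. a * s x + b * t x) \<in> product_space V W"
    if "s \<in> product_space V W" "t \<in> product_space V W" for s t a b
  proof -
    obtain v w v' w' where "s = case_sum v w" "t = case_sum v' w'" "v \<in> V" "w \<in> W" "v' \<in> V" "w' \<in> W"
      using \<open>s \<in> product_space V W\<close> \<open>t \<in> product_space V W\<close> by (auto simp: product_space_def)
    then show ?thesis using assms by (simp add: case_sum_lincomb function_space_lincomb)
  qed
  ultimately show ?thesis by (simp add: function_space_def)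
qed

lemma finitely_generated_product:
  assumes "finitely_generated V" "finitely_generated W"
  shows "finitely_generated (product_space V W)"
proof -
  obtain n g where g: "\<And>v. v \<in> V \<Longrightarrow> \<exists>c. \<forall>x. v x = (\<Sum>k<(n::nat). c k * g k x)"
    using assms(1) unfolding finitely_generated_def by blast
  obtain m h where h: "\<And>v. v \<in> W \<Longrightarrow> \<exists>c. \<forall>x. v x = (\<Sum>k<(m::nat). c k * h k x)"
    using assms(2) unfolding finitely_generated_def by blast
  define e where "e = case_sum (\<lambda>k. case_sum (g k) (\<lambda>_. 0)) (\<lambda>k. case_sum (\<lambda>_. 0) (h k))"
  show ?thesis
  proof (rule finitely_generatedI[where K = "{..<n} <+> {..<m}"])
    fix s assume "s \<in> product_space V W"
    then obtain v w where s: "s = case_sum v w" "v \<in> V" "w \<in> W"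
      by (auto simp: product_space_def)
    obtain c d where "\<And>x. v x = (\<Sum>k<n. c k * g k x)" "\<And>x. w x = (\<Sum>k<m. d k * h k x)"
      using g[OF s(2)] h[OF s(3)] by blast
    then have "s x = (\<Sum>k\<in>{..<n} <+> {..<m}. case_sum c d k * e k x)" for x
      by (cases x) (simp_all add: s(1) sum.Plus e_def)
    then show "\<exists>c. \<forall>x. s x = (\<Sum>k\<in>{..<n} <+> {..<m}. c k * e k x)" by blast
  qed auto
qed

section \<open>Discrete spaces and the two-step difference\<close>

text \<open>
  The nesting, with the factor \<open>1\<close>, is the one in which \<open>linear_on_space_lincomb\<close> can be applied
  twice.
\<close>

definition lincomb3 :: "real \<Rightarrow> real \<Rightarrow> real \<Rightarrow> ('b \<Rightarrow> real) \<Rightarrow> ('b \<Rightarrow> real) \<Rightarrow> ('b \<Rightarrow> real) \<Rightarrow> 'b \<Rightarrow> real" where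
  "lincomb3 \<alpha> \<beta> \<gamma> a b c = (\<lambda>x. \<alpha> * a x + 1 * (\<beta> * b x + \<gamma> * c x))"

text \<open>
  The analysis of the scheme is a Galerkin argument that sees the finite element space only through
  these properties. Vanishing outside the closure makes the \<open>L\<^sup>2\<close> inner product definite on \<open>V\<close>.
\<close>

locale discrete_space = bounded_open \<Omega> for \<Omega> :: "(real^'d::finite) set" +
  fixes V :: "((real^'d) \<Rightarrow> real) set"
  assumes V_space: "function_space V"
    and V_finite: "finitely_generated V"
    and V_continuous: "v \<in> V \<Longrightarrow> continuous_on (closure \<Omega>) v"
    and V_H1: "v \<in> V \<Longrightarrow> v \<in> H1 \<Omega>"
    and V_outside: "v \<in> V \<Longrightarrow> x \<notin> closure \<Omega> \<Longrightarrow> v x = 0"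
    and V_one: "(indicator (closure \<Omega>) :: _ \<Rightarrow> real) \<in> V"
begin

lemma V_L2: "v \<in> V \<Longrightarrow> v \<in> L2 \<Omega>"
  by (simp add: V_H1 H1_imp_L2)

lemma V_zero: "(\<lambda>_. 0) \<in> V"
  using V_space by (simp add: function_space_def)

lemma V_lincomb: "u \<in> V \<Longrightarrow> v \<in> V \<Longrightarrow> (\<lambda>x. a * u x + b * v x) \<in> V"
  by (rule function_space_lincomb[OF V_space])

lemma V_definite: "v \<in> V \<Longrightarrow> L2_inner \<Omega> v v = 0 \<Longrightarrow> v = (\<lambda>_. 0)"
  using L2_inner_definite V_continuous V_outside by (metis ext)

lemma L2_inner_zero [simp]: "L2_inner \<Omega> f (\<lambda>_. 0) = 0" "L2_inner \<Omega> (\<lambda>_. 0) f = 0"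
  by (simp_all add: L2_inner_def)

text \<open>
  The projection is defined by a definite description, so it is an element of \<open>V\<close> only because the
  problem that characterises it is uniquely solvable.
\<close>

lemma L2_proj_in_V:
  assumes f: "f \<in> L2 \<Omega>"
  shows "L2_proj \<Omega> V f \<in> V"
proof -
  have "\<exists>!p. p \<in> V \<and> (\<forall>\<phi>\<in>V. L2_inner \<Omega> p \<phi> = L2_inner \<Omega> f \<phi>)"
  proof (rule nondegenerate_form_solvable[OF V_space V_finite])
    show "linear_on_space V (\<lambda>u. L2_inner \<Omega> u t)" if "t \<in> V" for t
      using that V_L2 by (auto simp: linear_on_space_def L2_inner_lincomb_left)
    show "linear_on_space V (L2_inner \<Omega> u)" if "u \<in> V" for u
      using that V_L2 by (auto simp: linear_on_space_def L2_inner_lincomb_right)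
    show "linear_on_space V (L2_inner \<Omega> f)"
      using f V_L2 by (auto simp: linear_on_space_def L2_inner_lincomb_right)
    show "u = (\<lambda>_. 0)" if "u \<in> V" "\<And>t. t \<in> V \<Longrightarrow> L2_inner \<Omega> u t = 0" for u
      using that by (intro V_definite) auto
  qed
  moreover have "L2_inner \<Omega> p \<phi> = L2_inner \<Omega> f \<phi> \<longleftrightarrow> L2_inner \<Omega> (\<lambda>x. f x - p x) \<phi> = 0"
    if "p \<in> V" "\<phi> \<in> V" for p \<phi>
    using L2_inner_lincomb_left[OF f V_L2[OF that(1)] V_L2[OF that(2)], of 1 "-1"] by auto
  ultimately have "\<exists>!p. p \<in> V \<and> (\<forall>\<phi>\<in>V. L2_inner \<Omega> (\<lambda>x. f x - p x) \<phi> = 0)"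
    by (smt (verit, best))
  from theI'[OF this] show ?thesis by (simp add: L2_proj_def)
qed

lemma extrap_in_V: "u0 \<in> V \<Longrightarrow> u1 \<in> V \<Longrightarrow> extrap u0 u1 \<in> V"
  using V_lincomb[of u1 u0 2 "-1"] by (simp add: extrap_def)

lemma lincomb3_in_V: "a \<in> V \<Longrightarrow> b \<in> V \<Longrightarrow> c \<in> V \<Longrightarrow> lincomb3 \<alpha> \<beta> \<gamma> a b c \<in> V"
  unfolding lincomb3_def by (intro V_lincomb)

lemma linear_lincomb3:
  assumes "linear_on_space V L" "a \<in> V" "b \<in> V" "c \<in> V"
  shows "L (lincomb3 \<alpha> \<beta> \<gamma> a b c) = \<alpha> * L a + \<beta> * L b + \<gamma> * L c"
  unfolding lincomb3_def
  using assms by (simp only: linear_on_space_lincomb[OF assms(1)] V_lincomb) (simp add: algebra_simps)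

lemma bdf2_eq_lincomb3:
  "bdf2 dt c b a = lincomb3 (3 / (2 * dt)) (- 4 / (2 * dt)) (1 / (2 * dt)) a b c"
  by (auto simp: bdf2_def lincomb3_def fun_eq_iff add_divide_distrib diff_divide_distrib)

lemma bdf2_in_V: "a \<in> V \<Longrightarrow> b \<in> V \<Longrightarrow> c \<in> V \<Longrightarrow> bdf2 dt c b a \<in> V"
  by (simp add: bdf2_eq_lincomb3 lincomb3_in_V)

text \<open>
  Both sides are quadratic in \<open>(a, b, c)\<close>, and the identity is a comparison of coefficients:
  \<open>2 (3a - 4b + c) a = a\<^sup>2 + (2a - b)\<^sup>2 - b\<^sup>2 - (2b - c)\<^sup>2 + (a - 2b + c)\<^sup>2\<close>.
\<close>

lemma bdf2_identity:
  assumes Q_linear: "\<forall>t\<in>V. linear_on_space V (\<lambda>u. Q u t)" and sym: "\<And>u v. Q u v = Q v u"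
    and abc: "a \<in> V" "b \<in> V" "c \<in> V" and dt: "dt \<noteq> 0"
  shows "4 * dt * Q (bdf2 dt c b a) a =
    Q a a + Q (extrap b a) (extrap b a) - Q b b - Q (extrap c b) (extrap c b)
    + Q (\<lambda>x. a x - extrap c b x) (\<lambda>x. a x - extrap c b x)"
proof -
  have lin: "linear_on_space V (\<lambda>u. Q u t)" if "t \<in> V" for t
    using Q_linear that by blast
  have forms: "extrap b a = lincomb3 2 (-1) 0 a b c" "extrap c b = lincomb3 0 2 (-1) a b c"
    "(\<lambda>x. a x - extrap c b x) = lincomb3 1 (-2) 1 a b c"
    by (auto simp: extrap_def lincomb3_def fun_eq_iff)
  have lin': "linear_on_space V (Q t)" if "t \<in> V" for t
    using lin[OF that] by (simp add: sym[of _ t])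
  have square: "Q (lincomb3 \<alpha> \<beta> \<gamma> a b c) (lincomb3 \<alpha> \<beta> \<gamma> a b c) =
      \<alpha>\<^sup>2 * Q a a + \<beta>\<^sup>2 * Q b b + \<gamma>\<^sup>2 * Q c c
      + 2 * \<alpha> * \<beta> * Q a b + 2 * \<alpha> * \<gamma> * Q a c + 2 * \<beta> * \<gamma> * Q b c" for \<alpha> \<beta> \<gamma>
  proof -
    let ?l = "lincomb3 \<alpha> \<beta> \<gamma> a b c"
    have "Q ?l ?l = \<alpha> * Q a ?l + \<beta> * Q b ?l + \<gamma> * Q c ?l"
      by (rule linear_lincomb3[OF lin[OF lincomb3_in_V[OF abc]] abc])
    moreover have "Q a ?l = \<alpha> * Q a a + \<beta> * Q a b + \<gamma> * Q a c"
      by (rule linear_lincomb3[OF lin'[OF abc(1)] abc])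
    moreover have "Q b ?l = \<alpha> * Q a b + \<beta> * Q b b + \<gamma> * Q b c"
      unfolding sym[of a b] by (rule linear_lincomb3[OF lin'[OF abc(2)] abc])
    moreover have "Q c ?l = \<alpha> * Q a c + \<beta> * Q b c + \<gamma> * Q c c"
      unfolding sym[of a c] sym[of b c] by (rule linear_lincomb3[OF lin'[OF abc(3)] abc])
    ultimately show ?thesis
      by (simp only: power2_eq_square algebra_simps)
  qed
  have "4 * dt * Q (bdf2 dt c b a) a = 6 * Q a a - 8 * Q a b + 2 * Q a c"
    using linear_lincomb3[OF lin[OF abc(1)] abc, of "3 / (2 * dt)" "- 4 / (2 * dt)" "1 / (2 * dt)"] dt
    by (simp add: bdf2_eq_lincomb3 sym[of b a] sym[of c a] field_simps)
  then show ?thesis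
    unfolding forms(3) unfolding forms(1,2) unfolding square by simp
qed

end

section \<open>One step of the scheme\<close>

text \<open>
  The scheme is linear because mobility and \<open>H\<close> are evaluated at the extrapolation, which is known;
  \<open>m\<close> and \<open>\<eta>\<close> stand for the resulting coefficient functions.
\<close>

locale scheme_setting = discrete_space +
  fixes m \<eta> :: "real^'d \<Rightarrow> real" and \<epsilon> dt :: real
  assumes m_cont: "continuous_on (closure \<Omega>) m" and m_nonneg: "\<And>x. x \<in> \<Omega> \<Longrightarrow> m x \<ge> 0"
    and \<eta>_cont: "continuous_on (closure \<Omega>) \<eta>"
    and \<epsilon>_nz: "\<epsilon> \<noteq> 0" and dt_pos: "dt > 0"
begin

abbreviation "ip \<equiv> L2_inner \<Omega>"
abbreviation "Am \<equiv> A_form \<Omega> m"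
abbreviation "Ae \<equiv> A_form \<Omega> (\<lambda>x. \<epsilon>\<^sup>2)"

lemma ip_lincomb_left: "u \<in> V \<Longrightarrow> v \<in> V \<Longrightarrow> t \<in> V \<Longrightarrow> ip (\<lambda>x. a * u x + b * v x) t = a * ip u t + b * ip v t"
  by (intro L2_inner_lincomb_left V_L2)

lemma ip_lincomb_right: "u \<in> V \<Longrightarrow> v \<in> V \<Longrightarrow> t \<in> V \<Longrightarrow> ip t (\<lambda>x. a * u x + b * v x) = a * ip t u + b * ip t v"
  by (intro L2_inner_lincomb_right V_L2)

lemma \<eta>_mult_L2: "u \<in> V \<Longrightarrow> (\<lambda>x. \<eta> x * u x) \<in> L2 \<Omega>"
  by (intro L2_coeff_mult \<eta>_cont V_L2)

lemma ip\<eta>_lincomb_left: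
  assumes "u \<in> V" "v \<in> V" "t \<in> V"
  shows "ip (\<lambda>x. \<eta> x * (a * u x + b * v x)) t = a * ip (\<lambda>x. \<eta> x * u x) t + b * ip (\<lambda>x. \<eta> x * v x) t"
proof -
  have "(\<lambda>x. \<eta> x * (a * u x + b * v x)) = (\<lambda>x. a * (\<eta> x * u x) + b * (\<eta> x * v x))"
    by (auto simp: algebra_simps)
  then show ?thesis
    using assms by (simp only: L2_inner_lincomb_left \<eta>_mult_L2 V_L2)
qed

lemma ip\<eta>_lincomb_right:
  "u \<in> V \<Longrightarrow> v \<in> V \<Longrightarrow> t \<in> V \<Longrightarrow> ip (\<lambda>x. \<eta> x * t x) (\<lambda>x. a * u x + b * v x) =
    a * ip (\<lambda>x. \<eta> x * t x) u + b * ip (\<lambda>x. \<eta> x * t x) v"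
  by (intro L2_inner_lincomb_right V_L2 \<eta>_mult_L2)

lemma ip\<eta>_swap: "ip (\<lambda>x. \<eta> x * u x) v = ip (\<lambda>x. \<eta> x * v x) u"
  unfolding L2_inner_def by (intro Bochner_Integration.integral_cong) auto

lemmas A_lincomb_left =
  A_form_lincomb_left[OF m_cont V_H1 V_H1 V_H1] A_form_lincomb_left[OF continuous_on_const V_H1 V_H1 V_H1]

lemmas A_lincomb_right =
  A_form_lincomb_right[OF m_cont V_H1 V_H1 V_H1] A_form_lincomb_right[OF continuous_on_const V_H1 V_H1 V_H1]

lemmas forms_lincomb = ip_lincomb_left ip_lincomb_right ip\<eta>_lincomb_left ip\<eta>_lincomb_right
  A_lincomb_left A_lincomb_right

lemma A_zero:
  assumes "u \<in> V"
  shows "Am u (\<lambda>_. 0) = 0" "Ae u (\<lambda>_. 0) = 0"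
  using A_form_const_right[OF m_cont V_H1[OF assms] V_H1[OF V_zero] refl]
    A_form_const_right[OF continuous_on_const V_H1[OF assms] V_H1[OF V_zero] refl] by blast+

text \<open>
  Testing with \<open>(w, u, U)\<close> eliminates the terms with \<open>\<eta>\<close> and gives
  \<open>3 A(\<epsilon>\<^sup>2; u, u) + 6 (U, U) + 2 dt A(m; w, w) = 0\<close>, where every summand is nonnegative. The function
  \<open>u\<close> is then recovered from the first equation, in which \<open>A(m; w, u)\<close> vanishes although the
  gradient of \<open>w\<close> may not.
\<close>

lemma homogeneous_scheme_trivial:
  assumes V: "u \<in> V" "w \<in> V" "U \<in> V"
    and eq1: "\<And>\<phi>. \<phi> \<in> V \<Longrightarrow> 3 * ip u \<phi> + 2 * dt * Am w \<phi> = 0"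
    and eq2: "\<And>\<psi>. \<psi> \<in> V \<Longrightarrow> ip w \<psi> = Ae u \<psi> + ip (\<lambda>x. \<eta> x * U x) \<psi>"
    and eq3: "\<And>\<tau>. \<tau> \<in> V \<Longrightarrow> 3 * ip U \<tau> = 3 / 2 * ip (\<lambda>x. \<eta> x * u x) \<tau>"
  shows "u = (\<lambda>_. 0)" "w = (\<lambda>_. 0)" "U = (\<lambda>_. 0)"
proof -
  define D where "D = 2 * dt * Am w w"
  have "3 * ip u w + D = 0" unfolding D_def by (rule eq1[OF V(2)])
  moreover have "ip u w = Ae u u + ip (\<lambda>x. \<eta> x * U x) u"
    unfolding L2_inner_sym[of u w] by (rule eq2[OF V(1)])
  moreover have "3 * ip U U = 3 / 2 * ip (\<lambda>x. \<eta> x * U x) u"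
    unfolding ip\<eta>_swap[of U u] by (rule eq3[OF V(3)])
  ultimately have balance: "3 * Ae u u + 6 * ip U U + D = 0" by linarith
  have nonneg: "Ae u u \<ge> 0" "ip U U \<ge> 0" "D \<ge> 0"
    using dt_pos A_form_nonneg[of m w, OF m_nonneg]
    by (simp_all add: A_form_nonneg L2_inner_nonneg D_def)
  have zero: "Ae u u = 0" "ip U U = 0" "D = 0"
    subgoal using balance nonneg by linarith
    subgoal using balance nonneg by linarith
    subgoal using balance nonneg by linarith
    done
  show U: "U = (\<lambda>_. 0)" using V(3) zero(2) by (rule V_definite)
  have "Am w w = 0" using zero(3) dt_pos by (simp add: D_def)
  then have "Am w u = 0"
    using A_form_degenerate[OF m_cont _ V_H1[OF V(2)]] m_nonneg by blast
  with eq1[OF V(1)] have "ip u u = 0" by simp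
  then show "u = (\<lambda>_. 0)" by (rule V_definite[OF V(1)])
  have "Ae u w = 0"
    by (rule A_form_degenerate[OF continuous_on_const _ V_H1[OF V(1)] zero(1)]) simp
  with eq2[OF V(2)] U have "ip w w = 0" by simp
  then show "w = (\<lambda>_. 0)" by (rule V_definite[OF V(2)])
qed

text \<open>
  The system is written as one equation \<open>b s t = l t\<close> for the triple of unknowns against triples of
  test functions, and nondegeneracy of \<open>b\<close> is the triviality of the homogeneous scheme.
\<close>

lemma linear_scheme_solvable:
  assumes g: "g \<in> L2 \<Omega>" "G \<in> L2 \<Omega>"
  shows "\<exists>!s. case s of (u, w, U) \<Rightarrow> u \<in> V \<and> w \<in> V \<and> U \<in> V \<and>
     (\<forall>\<phi>\<in>V. 3 * ip u \<phi> + 2 * dt * Am w \<phi> = ip g \<phi>) \<and>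
     (\<forall>\<psi>\<in>V. ip w \<psi> = Ae u \<psi> + ip (\<lambda>x. \<eta> x * U x) \<psi>) \<and>
     (\<forall>\<tau>\<in>V. 3 * ip U \<tau> - 3 / 2 * ip (\<lambda>x. \<eta> x * u x) \<tau> = ip G \<tau>)"
    (is "\<exists>!s. case s of (u, w, U) \<Rightarrow> ?P u w U")
proof -
  define W where "W = product_space V (product_space V V)"
  define S where "S u w U \<phi> \<psi> \<tau> = (3 * ip u \<phi> + 2 * dt * Am w \<phi>)
      + (ip w \<psi> - Ae u \<psi> - ip (\<lambda>x. \<eta> x * U x) \<psi>)
      + (3 * ip U \<tau> - 3 / 2 * ip (\<lambda>x. \<eta> x * u x) \<tau>)" for u w U \<phi> \<psi> \<tau>
  define b where "b s t = S (\<lambda>x. s (Inl x)) (\<lambda>x. s (Inr (Inl x))) (\<lambda>x. s (Inr (Inr x)))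
      (\<lambda>x. t (Inl x)) (\<lambda>x. t (Inr (Inl x))) (\<lambda>x. t (Inr (Inr x)))"
    for s t :: "real^'d + real^'d + real^'d \<Rightarrow> real"
  define l where "l t = ip g (\<lambda>x. t (Inl x)) + ip G (\<lambda>x. t (Inr (Inr x)))" for t :: "real^'d + real^'d + real^'d \<Rightarrow> real"
  define triple where "triple u w U = case_sum u (case_sum w U)" for u w U :: "real^'d \<Rightarrow> real"
  have W_iff: "triple u w U \<in> W \<longleftrightarrow> u \<in> V \<and> w \<in> V \<and> U \<in> V" for u w U
    by (simp add: W_def triple_def)
  have W_cases: "\<exists>u w U. s = triple u w U \<and> u \<in> V \<and> w \<in> V \<and> U \<in> V" if "s \<in> W" for s
    using that by (fastforce simp: W_def triple_def product_space_def)
  have b_triple: "b (triple u w U) (triple \<phi> \<psi> \<tau>) = S u w U \<phi> \<psi> \<tau>" for u w U \<phi> \<psi> \<tau>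
    by (simp add: b_def triple_def)
  have l_triple: "l (triple \<phi> \<psi> \<tau>) = ip g \<phi> + ip G \<tau>" for \<phi> \<psi> \<tau>
    by (simp add: l_def triple_def)
  have triple_lincomb: "(\<lambda>x. a * triple u w U x + c * triple u' w' U' x) =
      triple (\<lambda>x. a * u x + c * u' x) (\<lambda>x. a * w x + c * w' x) (\<lambda>x. a * U x + c * U' x)" for a c u w U u' w' U'
    by (simp add: triple_def case_sum_lincomb)
  have W_space: "function_space W" "finitely_generated W"
    unfolding W_def by (intro function_space_product finitely_generated_product V_space V_finite)+
  have tested: "(\<forall>t\<in>W. b (triple u w U) t = l t) \<longleftrightarrow> 
     (\<forall>\<phi>\<in>V. 3 * ip u \<phi> + 2 * dt * Am w \<phi> = ip g \<phi>) \<and>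
     (\<forall>\<psi>\<in>V. ip w \<psi> = Ae u \<psi> + ip (\<lambda>x. \<eta> x * U x) \<psi>) \<and>
     (\<forall>\<tau>\<in>V. 3 * ip U \<tau> - 3 / 2 * ip (\<lambda>x. \<eta> x * u x) \<tau> = ip G \<tau>)"
    if V: "u \<in> V" "w \<in> V" "U \<in> V" for u w U
  proof (intro iffI conjI ballI)
    fix \<phi> assume *: "\<forall>t\<in>W. b (triple u w U) t = l t" "\<phi> \<in> V"
    \<comment> \<open>The three equations are separated by taking two of the three test functions to be zero.\<close>
    have test: "S u w U \<phi> \<psi> \<tau> = ip g \<phi> + ip G \<tau>" if "\<phi> \<in> V" "\<psi> \<in> V" "\<tau> \<in> V" for \<phi> \<psi> \<tau>
    proof -
      have "triple \<phi> \<psi> \<tau> \<in> W" using that by (simp add: W_iff)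
      from bspec[OF *(1) this] show ?thesis by (simp only: b_triple l_triple)
    qed
    show "3 * ip u \<phi> + 2 * dt * Am w \<phi> = ip g \<phi>"
      using test[OF *(2) V_zero V_zero] V by (simp add: S_def A_zero)
    show "ip w \<phi> = Ae u \<phi> + ip (\<lambda>x. \<eta> x * U x) \<phi>"
      using test[OF V_zero *(2) V_zero] V by (simp add: S_def A_zero)
    show "3 * ip U \<phi> - 3 / 2 * ip (\<lambda>x. \<eta> x * u x) \<phi> = ip G \<phi>"
      using test[OF V_zero V_zero *(2)] V by (simp add: S_def A_zero)
  next
    fix t assume *: "(\<forall>\<phi>\<in>V. 3 * ip u \<phi> + 2 * dt * Am w \<phi> = ip g \<phi>) \<and>
     (\<forall>\<psi>\<in>V. ip w \<psi> = Ae u \<psi> + ip (\<lambda>x. \<eta> x * U x) \<psi>) \<and>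
     (\<forall>\<tau>\<in>V. 3 * ip U \<tau> - 3 / 2 * ip (\<lambda>x. \<eta> x * u x) \<tau> = ip G \<tau>)" "t \<in> W"
    obtain \<phi> \<psi> \<tau> where "t = triple \<phi> \<psi> \<tau>" "\<phi> \<in> V" "\<psi> \<in> V" "\<tau> \<in> V"
      using W_cases[OF *(2)] by blast
    with *(1) show "b (triple u w U) t = l t"
      by (simp add: b_triple l_triple S_def)
  qed
  have solvable: "\<exists>!s. s \<in> W \<and> (\<forall>t\<in>W. b s t = l t)"
  proof (rule nondegenerate_form_solvable[OF W_space])
    show "linear_on_space W (\<lambda>s. b s t)" if "t \<in> W" for t
    proof -
      from W_cases[OF that]
      obtain \<phi> \<psi> \<tau> where t: "t = triple \<phi> \<psi> \<tau>" "\<phi> \<in> V" "\<psi> \<in> V" "\<tau> \<in> V" by blast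
      show ?thesis
        unfolding linear_on_space_def
      proof (intro ballI allI)
        fix s s' a c assume W: "s \<in> W" "s' \<in> W"
        obtain u w U u' w' U' where s: "s = triple u w U" "s' = triple u' w' U'"
          "u \<in> V" "w \<in> V" "U \<in> V" "u' \<in> V" "w' \<in> V" "U' \<in> V"
          using W_cases[OF W(1)] W_cases[OF W(2)] by blast
        show "b (\<lambda>x. a * s x + c * s' x) t = a * b s t + c * b s' t"
          unfolding s(1,2) t(1) triple_lincomb b_triple S_def
          using s(3-) t(2-) by (simp add: forms_lincomb) (simp add: algebra_simps)
      qed
    qed
    show "linear_on_space W (b s)" if "s \<in> W" for s
    proof -
      from W_cases[OF that]
      obtain u w U where s: "s = triple u w U" "u \<in> V" "w \<in> V" "U \<in> V" by blast
      show ?thesis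
        unfolding linear_on_space_def
      proof (intro ballI allI)
        fix t t' a c assume W: "t \<in> W" "t' \<in> W"
        obtain \<phi> \<psi> \<tau> \<phi>' \<psi>' \<tau>' where t: "t = triple \<phi> \<psi> \<tau>" "t' = triple \<phi>' \<psi>' \<tau>'"
          "\<phi> \<in> V" "\<psi> \<in> V" "\<tau> \<in> V" "\<phi>' \<in> V" "\<psi>' \<in> V" "\<tau>' \<in> V"
          using W_cases[OF W(1)] W_cases[OF W(2)] by blast
        show "b s (\<lambda>x. a * t x + c * t' x) = a * b s t + c * b s t'"
          unfolding t(1,2) s(1) triple_lincomb b_triple S_def
          using t(3-) s(2-) by (simp add: forms_lincomb) (simp add: algebra_simps)
      qed
    qed
    show "linear_on_space W l"
      unfolding linear_on_space_def
    proof (intro ballI allI)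
      fix t t' a c assume W: "t \<in> W" "t' \<in> W"
      obtain \<phi> \<psi> \<tau> \<phi>' \<psi>' \<tau>' where t: "t = triple \<phi> \<psi> \<tau>" "t' = triple \<phi>' \<psi>' \<tau>'"
        "\<phi> \<in> V" "\<psi> \<in> V" "\<tau> \<in> V" "\<phi>' \<in> V" "\<psi>' \<in> V" "\<tau>' \<in> V"
        using W_cases[OF W(1)] W_cases[OF W(2)] by blast
      show "l (\<lambda>x. a * t x + c * t' x) = a * l t + c * l t'"
        unfolding t(1,2) triple_lincomb l_triple
        using t(3-) g by (simp add: L2_inner_lincomb_right V_L2) (simp add: algebra_simps)
    qed
    show "s = (\<lambda>_. 0)" if "s \<in> W" and zero: "\<And>t. t \<in> W \<Longrightarrow> b s t = 0" for s
    proof -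
      obtain u w U where s: "s = triple u w U" and V: "u \<in> V" "w \<in> V" "U \<in> V"
        using W_cases[OF \<open>s \<in> W\<close>] by blast
      have test: "S u w U \<phi> \<psi> \<tau> = 0" if "\<phi> \<in> V" "\<psi> \<in> V" "\<tau> \<in> V" for \<phi> \<psi> \<tau>
      proof -
        have "triple \<phi> \<psi> \<tau> \<in> W" using that by (simp add: W_iff)
        from zero[OF this] show ?thesis by (simp only: s b_triple)
      qed
      have "3 * ip u \<phi> + 2 * dt * Am w \<phi> = 0"
        "ip w \<phi> = Ae u \<phi> + ip (\<lambda>x. \<eta> x * U x) \<phi>"
        "3 * ip U \<phi> = 3 / 2 * ip (\<lambda>x. \<eta> x * u x) \<phi>" if "\<phi> \<in> V" for \<phi>
        using test[OF that V_zero V_zero] test[OF V_zero that V_zero] test[OF V_zero V_zero that] V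
        by (simp_all add: S_def A_zero)
      from homogeneous_scheme_trivial[OF V this] show ?thesis
        by (simp add: s triple_def case_sum_0)
    qed
  qed
  have P_iff: "?P u w U \<longleftrightarrow> triple u w U \<in> W \<and> (\<forall>t\<in>W. b (triple u w U) t = l t)" for u w U
    using tested[of u w U] W_iff[of u w U] by blast
  from solvable obtain s where s: "s \<in> W" "\<forall>t\<in>W. b s t = l t"
    and unique: "\<And>s'. s' \<in> W \<Longrightarrow> (\<forall>t\<in>W. b s' t = l t) \<Longrightarrow> s' = s" by (auto elim!: ex1E)
  obtain u w U where uwU: "s = triple u w U" using W_cases[OF s(1)] by blast
  show ?thesis
  proof (rule ex1I[of _ "(u, w, U)"])
    show "case (u, w, U) of (u, w, U) \<Rightarrow> ?P u w U"
      using P_iff s uwU by simp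
    fix r assume r: "case r of (u, w, U) \<Rightarrow> ?P u w U"
    obtain u' w' U' where r': "r = (u', w', U')" by (cases r)
    with r have "triple u' w' U' = s" using P_iff unique by simp
    then show "r = (u, w, U)" by (simp add: r' uwU triple_def case_sum_inject)
  qed
qed

text \<open>
  Separates the unknown level from the two known levels, which form the right-hand side of the linear
  system.
\<close>

lemma bdf2_rearrange:
  assumes "a \<in> V" "b \<in> V" "c \<in> V" "t \<in> V"
  shows "ip (bdf2 dt c b a) t = (3 * ip a t - ip (\<lambda>x. 4 * b x + (-1) * c x) t) / (2 * dt)"
    and "ip (\<lambda>x. 1/2 * \<eta> x * bdf2 dt c b a x) t =
      (3/2 * ip (\<lambda>x. \<eta> x * a x) t - 1/2 * ip (\<lambda>x. \<eta> x * (4 * b x + (-1) * c x)) t) / (2 * dt)"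
proof -
  have bc: "(\<lambda>x. 4 * b x + (-1) * c x) \<in> V" using assms by (intro V_lincomb)
  have "bdf2 dt c b a = (\<lambda>x. 3 / (2 * dt) * a x + (- 1 / (2 * dt)) * (4 * b x + (-1) * c x))"
    by (simp add: bdf2_def fun_eq_iff add_divide_distrib diff_divide_distrib)
  then show "ip (bdf2 dt c b a) t = (3 * ip a t - ip (\<lambda>x. 4 * b x + (-1) * c x) t) / (2 * dt)"
    using ip_lincomb_left[OF assms(1) bc assms(4), of "3 / (2 * dt)" "- 1 / (2 * dt)"]
    by (simp add: diff_divide_distrib)
  have "(\<lambda>x. 1/2 * \<eta> x * bdf2 dt c b a x) =
      (\<lambda>x. \<eta> x * (3 / (4 * dt) * a x + (- 1 / (4 * dt)) * (4 * b x + (-1) * c x)))"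
    using dt_pos by (simp add: bdf2_def fun_eq_iff field_simps)
  then show "ip (\<lambda>x. 1/2 * \<eta> x * bdf2 dt c b a x) t =
      (3/2 * ip (\<lambda>x. \<eta> x * a x) t - 1/2 * ip (\<lambda>x. \<eta> x * (4 * b x + (-1) * c x)) t) / (2 * dt)"
    using ip\<eta>_lincomb_left[OF assms(1) bc assms(4), of "3 / (4 * dt)" "- 1 / (4 * dt)"]
    by (simp add: diff_divide_distrib)
qed

end

locale scheme_data = discrete_space +
  fixes M H :: "real \<Rightarrow> real" and \<epsilon> dt :: real and u0 u1 U0 U1 :: "real^'d \<Rightarrow> real"
  assumes data: "u0 \<in> V" "u1 \<in> V" "U0 \<in> V" "U1 \<in> V"
    and M_cont: "continuous_on (closure \<Omega>) (\<lambda>x. M (extrap u0 u1 x))"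
    and M_nonneg: "\<And>x. x \<in> \<Omega> \<Longrightarrow> M (extrap u0 u1 x) \<ge> 0"
    and H_cont: "continuous_on (closure \<Omega>) (\<lambda>x. H (extrap u0 u1 x))"
    and \<epsilon>_nonzero: "\<epsilon> \<noteq> 0" and dt_positive: "dt > 0"

sublocale scheme_data \<subseteq> scheme_setting \<Omega> V "\<lambda>x. M (extrap u0 u1 x)" "\<lambda>x. H (extrap u0 u1 x)" \<epsilon> dt
  by unfold_locales (use M_cont M_nonneg H_cont \<epsilon>_nonzero dt_positive in auto)

context scheme_data
begin

text \<open>
  After multiplication of the two evolution equations by \<open>2 dt\<close>, the scheme has the form that
  \<open>linear_scheme_solvable\<close> treats.
\<close>

theorem scheme_step_unique_solution:
  "\<exists>!s. case s of (u, w, U) \<Rightarrow> scheme_step \<Omega> V \<epsilon> M H dt u0 u1 U0 U1 u w U"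
proof -
  let ?\<eta> = "\<lambda>x. H (extrap u0 u1 x)"
  define g where "g = (\<lambda>x. 4 * u1 x + (-1) * u0 x)"
  define G where "G = (\<lambda>x. 4 * U1 x + (-1) * U0 x)"
  define G' where "G' = (\<lambda>x. 1 * G x + (- 1/2) * (?\<eta> x * g x))"
  have V: "g \<in> V" "G \<in> V" 
    using data V_lincomb[of u1 u0 4 "-1"] V_lincomb[of U1 U0 4 "-1"] by (simp_all add: g_def G_def)
  have L2: "g \<in> L2 \<Omega>" "G' \<in> L2 \<Omega>"
    unfolding G'_def by (rule V_L2[OF V(1)], rule L2_lincomb[OF V_L2[OF V(2)] \<eta>_mult_L2[OF V(1)]])
  have G': "ip G' \<tau> = ip G \<tau> - 1/2 * ip (\<lambda>x. ?\<eta> x * g x) \<tau>" if "\<tau> \<in> V" for \<tau>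
    using L2_inner_lincomb_left[OF V_L2[OF V(2)] \<eta>_mult_L2[OF V(1)] V_L2[OF that], of 1 "-1/2"]
    by (simp add: G'_def)
  have eq1: "ip (bdf2 dt u0 u1 u) \<phi> = - Am w \<phi> \<longleftrightarrow> 3 * ip u \<phi> + 2 * dt * Am w \<phi> = ip g \<phi>"
    if "u \<in> V" "\<phi> \<in> V" for u w \<phi>
    using dt_pos unfolding bdf2_rearrange(1)[OF that(1) data(2,1) that(2)] g_def[symmetric]
    by (auto simp: field_simps)
  have eq3: "ip (bdf2 dt U0 U1 U) \<tau> = ip (\<lambda>x. 1/2 * ?\<eta> x * bdf2 dt u0 u1 u x) \<tau> \<longleftrightarrow>
      3 * ip U \<tau> - 3 / 2 * ip (\<lambda>x. ?\<eta> x * u x) \<tau> = ip G' \<tau>"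
    if "u \<in> V" "U \<in> V" "\<tau> \<in> V" for u U \<tau>
    unfolding bdf2_rearrange(1)[OF that(2) data(4,3) that(3)]
      bdf2_rearrange(2)[OF that(1) data(2,1) that(3)] G'[OF that(3)] g_def G_def divide_cancel_right
    using dt_pos by auto
  have "scheme_step \<Omega> V \<epsilon> M H dt u0 u1 U0 U1 u w U \<longleftrightarrow> u \<in> V \<and> w \<in> V \<and> U \<in> V \<and>
     (\<forall>\<phi>\<in>V. 3 * ip u \<phi> + 2 * dt * Am w \<phi> = ip g \<phi>) \<and>
     (\<forall>\<psi>\<in>V. ip w \<psi> = Ae u \<psi> + ip (\<lambda>x. ?\<eta> x * U x) \<psi>) \<and>
     (\<forall>\<tau>\<in>V. 3 * ip U \<tau> - 3 / 2 * ip (\<lambda>x. ?\<eta> x * u x) \<tau> = ip G' \<tau>)" for u w U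
    unfolding scheme_step_def using eq1 eq3 by blast
  then show ?thesis using linear_scheme_solvable[OF L2] by simp
qed

text \<open>
  Testing the first equation with the constant function removes the diffusion term.
\<close>

lemma scheme_step_mass:
  assumes "scheme_step \<Omega> V \<epsilon> M H dt u0 u1 U0 U1 u w U"
  shows "3 * integral\<^sup>L (lebesgue_on \<Omega>) u =
    4 * integral\<^sup>L (lebesgue_on \<Omega>) u1 - integral\<^sup>L (lebesgue_on \<Omega>) u0"
proof -
  let ?one = "indicator (closure \<Omega>) :: _ \<Rightarrow> real"
  have ip_one: "ip f ?one = integral\<^sup>L (lebesgue_on \<Omega>) f" for f
    unfolding L2_inner_def using closure_subset[of \<Omega>]
    by (intro Bochner_Integration.integral_cong) (auto simp: indicator_def)
  have V: "u \<in> V" "w \<in> V" and "ip (bdf2 dt u0 u1 u) ?one = - Am w ?one"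
    using assms V_one by (auto simp: scheme_step_def)
  moreover have "Am w ?one = 0"
    using V V_one closure_subset[of \<Omega>]
    by (intro A_form_const_right[where c = 1] m_cont V_H1) (auto simp: indicator_def)
  ultimately have "3 * ip u ?one = ip (\<lambda>x. 4 * u1 x + (-1) * u0 x) ?one"
    using dt_pos unfolding bdf2_rearrange(1)[OF V(1) data(2,1) V_one] by simp
  then show ?thesis
    unfolding ip_lincomb_left[OF data(2,1) V_one] ip_one by simp
qed

text \<open>
  Testing with \<open>(w, \<delta>u, U)\<close>, the terms with \<open>H\<close> in the last two equations cancel, and
  \<open>bdf2_identity\<close> is applied to both remaining forms. The term with \<open>B\<close> is constant in time.
\<close>

lemma scheme_step_energy:
  assumes step: "scheme_step \<Omega> V \<epsilon> M H dt u0 u1 U0 U1 u w U"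
  shows "1/2 * (energy \<Omega> \<epsilon> B u U + energy \<Omega> \<epsilon> B (extrap u1 u) (extrap U1 U)) =
    1/2 * (energy \<Omega> \<epsilon> B u1 U1 + energy \<Omega> \<epsilon> B (extrap u0 u1) (extrap U0 U1))
    - dt * Am w w
    - 1/4 * Ae (\<lambda>x. u x - extrap u0 u1 x) (\<lambda>x. u x - extrap u0 u1 x)
    - 1/2 * (L2_norm \<Omega> (\<lambda>x. U x - extrap U0 U1 x))\<^sup>2"
proof -
  have V: "u \<in> V" "w \<in> V" "U \<in> V" using step by (auto simp: scheme_step_def)
  let ?\<eta> = "\<lambda>x. H (extrap u0 u1 x)"
  let ?\<delta>u = "bdf2 dt u0 u1 u" and ?\<delta>U = "bdf2 dt U0 U1 U"
  have \<delta>u: "?\<delta>u \<in> V" using V data by (intro bdf2_in_V)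
  have "ip ?\<delta>u w = - Am w w" using step V by (simp add: scheme_step_def)
  moreover have "ip w ?\<delta>u = Ae u ?\<delta>u + ip (\<lambda>x. ?\<eta> x * U x) ?\<delta>u"
    using step \<delta>u by (simp add: scheme_step_def)
  moreover have "ip ?\<delta>U U = 1/2 * ip (\<lambda>x. ?\<eta> x * U x) ?\<delta>u"
  proof -
    have "ip ?\<delta>U U = ip (\<lambda>x. 1/2 * ?\<eta> x * ?\<delta>u x) U"
      using step V by (simp add: scheme_step_def)
    also have "\<dots> = (\<integral>x. 1/2 * (?\<eta> x * U x * ?\<delta>u x) \<partial>lebesgue_on \<Omega>)"
      unfolding L2_inner_def by (intro Bochner_Integration.integral_cong) auto
    also have "\<dots> = 1/2 * ip (\<lambda>x. ?\<eta> x * U x) ?\<delta>u"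
      unfolding L2_inner_def by (rule integral_mult_right_zero)
    finally show ?thesis .
  qed
  ultimately have dissipation: "Am w w = - Ae ?\<delta>u u - 2 * ip ?\<delta>U U"
    by (simp add: L2_inner_sym[of w] A_form_sym[of _ u])
  have lin: "\<forall>t\<in>V. linear_on_space V (\<lambda>v. Ae v t)" "\<forall>t\<in>V. linear_on_space V (\<lambda>v. ip v t)"
    by (auto simp: linear_on_space_def forms_lincomb)
  have nz: "dt \<noteq> 0" using dt_pos by simp
  note u_id = bdf2_identity[OF lin(1) A_form_sym V(1) data(2,1) nz]
  note U_id = bdf2_identity[OF lin(2) L2_inner_sym V(3) data(4,3) nz]
  have energy_eq: "energy \<Omega> \<epsilon> B v W = 1/2 * Ae v v + ip W W - B * measure lebesgue \<Omega>" for v W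
    by (simp add: energy_def L2_inner_def power2_eq_square)
  have "dt * Am w w = - (dt * Ae ?\<delta>u u) - 2 * (dt * ip ?\<delta>U U)"
    by (simp add: dissipation right_diff_distrib)
  with u_id U_id show ?thesis
    unfolding energy_eq L2_norm_square by (simp add: field_simps)
qed

end

section \<open>The finite element space\<close>

lemma finite_multi_indices: "finite {\<alpha> :: 'd::finite \<Rightarrow> nat. (\<Sum>i\<in>UNIV. \<alpha> i) \<le> k}"
proof (rule finite_subset)
  show "{\<alpha> :: 'd \<Rightarrow> nat. (\<Sum>i\<in>UNIV. \<alpha> i) \<le> k} \<subseteq> (\<Pi>\<^sub>E i\<in>UNIV. {..k})"
  proof
    fix \<alpha> :: "'d \<Rightarrow> nat" assume "\<alpha> \<in> {\<alpha>. (\<Sum>i\<in>UNIV. \<alpha> i) \<le> k}"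
    moreover have "\<alpha> i \<le> (\<Sum>i\<in>UNIV. \<alpha> i)" for i by (intro member_le_sum) auto
    ultimately show "\<alpha> \<in> (\<Pi>\<^sub>E i\<in>UNIV. {..k})" by (auto intro: order_trans)
  qed
  show "finite (\<Pi>\<^sub>E i\<in>(UNIV :: 'd set). {..k})" by (intro finite_PiE) auto
qed

lemma poly_on_lincomb:
  assumes "poly_on k T v" "poly_on k T w"
  shows "poly_on k T (\<lambda>x. a * v x + b * w x)"
proof -
  obtain c d where "\<And>x. x \<in> T \<Longrightarrow> v x = (\<Sum>\<alpha> | (\<Sum>i\<in>UNIV. \<alpha> i) \<le> k. c \<alpha> * (\<Prod>i\<in>UNIV. (x $ i) ^ \<alpha> i))"
    "\<And>x. x \<in> T \<Longrightarrow> w x = (\<Sum>\<alpha> | (\<Sum>i\<in>UNIV. \<alpha> i) \<le> k. d \<alpha> * (\<Prod>i\<in>UNIV. (x $ i) ^ \<alpha> i))"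
    using assms unfolding poly_on_def by blast
  then show ?thesis
    unfolding poly_on_def
    by (intro exI[of _ "\<lambda>\<alpha>. a * c \<alpha> + b * d \<alpha>"])
      (simp add: sum_distrib_left sum.distrib[symmetric] algebra_simps)
qed

lemma poly_on_const:
  fixes T :: "(real^'d::finite) set"
  assumes "\<And>x. x \<in> T \<Longrightarrow> v x = a"
  shows "poly_on k T v"
proof -
  let ?z = "\<lambda>_ :: 'd. 0 :: nat"
  have "v x = (\<Sum>\<alpha> | (\<Sum>i\<in>UNIV. \<alpha> i) \<le> k. (if \<alpha> = ?z then a else 0) * (\<Prod>i\<in>UNIV. (x $ i) ^ \<alpha> i))"
    if "x \<in> T" for x
  proof -
    have "(\<Sum>\<alpha> | (\<Sum>i\<in>UNIV. \<alpha> i) \<le> k. (if \<alpha> = ?z then a else 0) * (\<Prod>i\<in>UNIV. (x $ i) ^ \<alpha> i)) =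
        (\<Sum>\<alpha> | (\<Sum>i\<in>UNIV. \<alpha> i) \<le> k. if \<alpha> = ?z then a else 0)"
      by (intro sum.cong) auto
    also have "\<dots> = a" using finite_multi_indices[of k] by (subst sum.delta) auto
    finally show ?thesis using assms that by simp
  qed
  then show ?thesis
    unfolding poly_on_def by (intro exI[of _ "\<lambda>\<alpha>. if \<alpha> = ?z then a else 0"] ballI)
qed

text \<open>
  The generators are the monomials on single cells. A point on an interface lies in several cells, so
  one of them is selected for each point; otherwise the contributions would be counted twice.
\<close>

lemma finitely_generated_Vh:
  fixes \<T> :: "(real^'d::finite) set set"
  assumes \<T>: "finite \<T>" "\<Union>\<T> = closure \<Omega>"
  shows "finitely_generated (Vh k \<T> \<Omega>)"
proof -
  define A where "A = {\<alpha> :: 'd \<Rightarrow> nat. (\<Sum>i\<in>UNIV. \<alpha> i) \<le> k}"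
  have A: "finite A" unfolding A_def by (rule finite_multi_indices)
  define cell where "cell x = (SOME T. T \<in> \<T> \<and> x \<in> T)" for x
  have cell: "cell x \<in> \<T>" "x \<in> cell x" if "x \<in> closure \<Omega>" for x
  proof -
    have "\<exists>T. T \<in> \<T> \<and> x \<in> T" using that \<T>(2) by blast
    from someI_ex[OF this] show "cell x \<in> \<T>" "x \<in> cell x" by (simp_all add: cell_def)
  qed
  define e where "e = (\<lambda>(T, \<alpha>) x. if x \<in> closure \<Omega> \<and> cell x = T then \<Prod>i\<in>UNIV. (x $ i) ^ \<alpha> i else 0)"
  show ?thesis
  proof (rule finitely_generatedI[where K = "\<T> \<times> A"])
    show "finite (\<T> \<times> A)" using \<T>(1) A by simp
    fix v assume v: "v \<in> Vh k \<T> \<Omega>"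
    then have "\<forall>T\<in>\<T>. \<exists>c. \<forall>x\<in>T. v x = (\<Sum>\<alpha>\<in>A. c \<alpha> * (\<Prod>i\<in>UNIV. (x $ i) ^ \<alpha> i))"
      by (simp add: Vh_def poly_on_def A_def)
    from bchoice[OF this] obtain c where
      c: "\<And>T x. T \<in> \<T> \<Longrightarrow> x \<in> T \<Longrightarrow> v x = (\<Sum>\<alpha>\<in>A. c T \<alpha> * (\<Prod>i\<in>UNIV. (x $ i) ^ \<alpha> i))"
      by blast
    have "v x = (\<Sum>p\<in>\<T> \<times> A. case_prod c p * e p x)" for x
    proof (cases "x \<in> closure \<Omega>")
      case True
      have "(\<Sum>p\<in>\<T> \<times> A. case_prod c p * e p x) = (\<Sum>T\<in>\<T>. \<Sum>\<alpha>\<in>A. c T \<alpha> * e (T, \<alpha>) x)"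
        by (simp add: sum.cartesian_product split_beta)
      also have "\<dots> = (\<Sum>T\<in>\<T>. if T = cell x then v x else 0)"
        using True cell[OF True] c by (intro sum.cong) (auto simp: e_def)
      also have "\<dots> = v x" using \<T>(1) cell(1)[OF True] by (subst sum.delta) auto
      finally show ?thesis by simp
    next
      case False
      then show ?thesis using v by (simp add: Vh_def e_def split_beta)
    qed
    then show "\<exists>c. \<forall>x. v x = (\<Sum>p\<in>\<T> \<times> A. c p * e p x)" by blast
  qed
qed

lemma discrete_space_Vh:
  fixes \<T> :: "(real^'d::finite) set set"
  assumes "open \<Omega>" "bounded \<Omega>" and \<T>: "finite \<T>" "\<Union>\<T> = closure \<Omega>"
  shows "discrete_space \<Omega> (Vh k \<T> \<Omega>)"
proof -
  interpret bounded_open \<Omega> using assms by unfold_locales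
  have const_H1: "v \<in> H1 \<Omega>" if "continuous_on (closure \<Omega>) v" "\<And>x. x \<in> \<Omega> \<Longrightarrow> v x = c" for v c
    using that is_weak_grad_const continuous_on_closure_L2 unfolding H1_def by blast
  have const_Vh: "v \<in> Vh k \<T> \<Omega>"
    if "\<And>x. x \<in> closure \<Omega> \<Longrightarrow> v x = c" "\<And>x. x \<notin> closure \<Omega> \<Longrightarrow> v x = 0" for v c
  proof -
    have "continuous_on (closure \<Omega>) v" using that(1) by (simp cong: continuous_on_cong)
    moreover have "v \<in> H1 \<Omega>"
      using calculation that(1) closure_subset[of \<Omega>] by (intro const_H1[of _ c]) auto
    moreover have "poly_on k T v" if "T \<in> \<T>" for T
      using \<open>T \<in> \<T>\<close> \<T>(2) that(1) \<open>\<And>x. x \<in> closure \<Omega> \<Longrightarrow> v x = c\<close> by (intro poly_on_const[of _ _ c]) blast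
    ultimately show ?thesis using that(2) by (simp add: Vh_def)
  qed
  show ?thesis
  proof unfold_locales
    show "function_space (Vh k \<T> \<Omega>)"
      unfolding function_space_def
    proof (intro conjI ballI allI)
      show "(\<lambda>_. 0) \<in> Vh k \<T> \<Omega>" by (rule const_Vh) auto
      show "(\<lambda>x. a * u x + b * v x) \<in> Vh k \<T> \<Omega>" if "u \<in> Vh k \<T> \<Omega>" "v \<in> Vh k \<T> \<Omega>" for u v a b
        using that by (auto simp: Vh_def intro!: continuous_intros H1_lincomb poly_on_lincomb)
    qed
    show "finitely_generated (Vh k \<T> \<Omega>)" by (rule finitely_generated_Vh[OF \<T>])
    show "(indicator (closure \<Omega>) :: _ \<Rightarrow> real) \<in> Vh k \<T> \<Omega>"
      by (rule const_Vh[of _ 1]) auto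
  qed (auto simp: Vh_def)
qed

text \<open>
  Admissibility keeps the values of the extrapolation where \<open>M\<close>, \<open>F'\<close> and the square root in \<open>H\<close> are
  continuous and the denominator is nonzero, so the coefficients of the scheme are continuous on the
  closure, hence bounded.
\<close>

lemma admissible_coefficients:
  assumes F: "\<And>s. s \<in> I \<Longrightarrow> (F has_real_derivative F' s) (at s within I)" "continuous_on I F'"
    and M: "continuous_on J M"
    and v: "continuous_on (closure \<Omega>) v" and adm: "admissible F B I J \<Omega> v"
  shows "continuous_on (closure \<Omega>) (\<lambda>x. M (v x))"
    and "continuous_on (closure \<Omega>) (\<lambda>x. H_fun F F' B (v x))"
proof -
  have range: "v x \<in> I" "F (v x) + B > 0" "v x \<in> J" if "x \<in> closure \<Omega>" for x
    using adm that by (auto simp: admissible_def)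
  have F_cont: "continuous_on I F"
    using F(1) by (meson DERIV_continuous continuous_on_eq_continuous_within)
  show "continuous_on (closure \<Omega>) (\<lambda>x. M (v x))"
    using range(3) by (intro continuous_on_compose2[OF M v]) auto
  have "continuous_on (closure \<Omega>) (\<lambda>x. F (v x))" "continuous_on (closure \<Omega>) (\<lambda>x. F' (v x))"
    using range(1) by (auto intro!: continuous_on_compose2[OF F_cont v] continuous_on_compose2[OF F(2) v])
  moreover have "sqrt (F (v x) + B) \<noteq> 0" if "x \<in> closure \<Omega>" for x
    using range(2)[OF that] by simp
  ultimately show "continuous_on (closure \<Omega>) (\<lambda>x. H_fun F F' B (v x))"
    unfolding H_fun_def by (intro continuous_intros ballI)
qed

section \<open>Well-posedness, mass conservation and energy dissipation\<close>

theorem lemmaA1: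
  fixes \<Omega> :: "(real^'d::finite) set" and \<T> :: "(real^'d) set set"
    and k :: nat and \<rho> \<epsilon> B dt :: real
    and I J :: "real set" and F F' M :: "real \<Rightarrow> real"
    and u_init :: "(real^'d) \<Rightarrow> real"
  assumes dim: "CARD('d) = 2 \<or> CARD('d) = 3"
    and domain: "open \<Omega>" "connected \<Omega>" "bounded \<Omega>" "\<Omega> \<noteq> {}"
    and mesh: "quasi_uniform_triangulation \<rho> \<T> \<Omega>"
    and k: "k \<ge> 1"
    and eps: "\<epsilon> > 0"
    and I: "is_interval I"
    and F: "\<And>s. s \<in> I \<Longrightarrow> (F has_real_derivative F' s) (at s within I)" "continuous_on I F'"
    and B: "B \<ge> 0"
    and M: "continuous_on J M" "\<And>s. s \<in> J \<Longrightarrow> M s \<ge> 0"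
    and init_L2: "u_init \<in> L2 \<Omega>" "(\<lambda>x. sqrt (F (u_init x) + B)) \<in> L2 \<Omega>"
    and init_adm: "AE x in lebesgue_on \<Omega>. u_init x \<in> I \<and> F (u_init x) + B > 0"
    and dt: "dt > 0"
  shows
    "(\<forall>u0\<in>Vh k \<T> \<Omega>. \<forall>u1\<in>Vh k \<T> \<Omega>. \<forall>U0\<in>Vh k \<T> \<Omega>. \<forall>U1\<in>Vh k \<T> \<Omega>.
        admissible F B I J \<Omega> (extrap u0 u1) \<longrightarrow>
        (\<exists>!s. case s of (u, w, U) \<Rightarrow>
           scheme_step \<Omega> (Vh k \<T> \<Omega>) \<epsilon> M (H_fun F F' B) dt u0 u1 U0 U1 u w U)) \<and>
     (\<forall>N u w U. scheme_solution \<Omega> (Vh k \<T> \<Omega>) \<epsilon> M F F' B I J dt u_init N u w U \<longrightarrow>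
        (\<forall>n. 0 < n \<and> n \<le> N \<longrightarrow>
           integral\<^sup>L (lebesgue_on \<Omega>) (u n) = integral\<^sup>L (lebesgue_on \<Omega>) (u 0)) \<and>
        (\<forall>n. 0 \<le> n \<and> n < N \<longrightarrow>
           mean_energy \<Omega> \<epsilon> B u U (n + 1) =
             mean_energy \<Omega> \<epsilon> B u U n
             - dt * A_form \<Omega> (\<lambda>x. M (extrap (u (n - 1)) (u n) x)) (w (n + 1)) (w (n + 1))
             - 1/4 * A_form \<Omega> (\<lambda>x. \<epsilon>\<^sup>2)
                 (\<lambda>x. u (n + 1) x - extrap (u (n - 1)) (u n) x)
                 (\<lambda>x. u (n + 1) x - extrap (u (n - 1)) (u n) x)
             - 1/2 * (L2_norm \<Omega> (\<lambda>x. U (n + 1) x - extrap (U (n - 1)) (U n) x))\<^sup>2))"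
proof -
  have \<T>: "finite \<T>" "\<Union>\<T> = closure \<Omega>"
    using mesh by (auto simp: quasi_uniform_triangulation_def triangulation_def)
  let ?V = "Vh k \<T> \<Omega>" and ?H = "H_fun F F' B"
  interpret discrete_space \<Omega> ?V
    using domain(1,3) \<T> by (rule discrete_space_Vh)
  have data: "scheme_data \<Omega> ?V M ?H \<epsilon> dt u0 u1 U0 U1"
    if "u0 \<in> ?V" "u1 \<in> ?V" "U0 \<in> ?V" "U1 \<in> ?V" and adm: "admissible F B I J \<Omega> (extrap u0 u1)"
    for u0 u1 U0 U1
  proof -
    note coeffs = admissible_coefficients[OF F M(1) V_continuous[OF extrap_in_V[OF that(1,2)]] adm]
    have "M (extrap u0 u1 x) \<ge> 0" if "x \<in> \<Omega>" for x
      using adm that closure_subset[of \<Omega>] M(2) by (auto simp: admissible_def)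
    with coeffs show ?thesis using that eps dt by unfold_locales auto
  qed
  show ?thesis
  proof (intro conjI ballI impI allI)
    fix u0 u1 U0 U1
    assume "u0 \<in> ?V" "u1 \<in> ?V" "U0 \<in> ?V" "U1 \<in> ?V" "admissible F B I J \<Omega> (extrap u0 u1)"
    then interpret scheme_data \<Omega> ?V M ?H \<epsilon> dt u0 u1 U0 U1 by (rule data)
    show "\<exists>!s. case s of (u, w, U) \<Rightarrow> scheme_step \<Omega> ?V \<epsilon> M ?H dt u0 u1 U0 U1 u w U"
      by (rule scheme_step_unique_solution)
  next
    fix N u w U
    assume sol: "scheme_solution \<Omega> ?V \<epsilon> M F F' B I J dt u_init N u w U"
    have step: "scheme_step \<Omega> ?V \<epsilon> M ?H dt (u (n - 1)) (u n) (U (n - 1)) (U n) (u (n + 1)) (w (n + 1)) (U (n + 1))"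
      and adm: "admissible F B I J \<Omega> (extrap (u (n - 1)) (u n))" if "0 \<le> n" "n < N" for n
      using sol that by (auto simp: scheme_solution_def)
    have init: "u (-1) = u 0" "u 0 \<in> ?V" "U (-1) = U 0" "U 0 \<in> ?V"
      using sol L2_proj_in_V[OF init_L2(1)] L2_proj_in_V[OF init_L2(2)] by (simp_all add: scheme_solution_def)
    have in_V: "u n \<in> ?V \<and> U n \<in> ?V" if "-1 \<le> n" "n \<le> N \<or> n \<le> 0" for n
    proof (cases "n \<le> 0")
      case True
      then have "n = -1 \<or> n = 0" using that by auto
      then show ?thesis using init by auto
    next
      case False
      then show ?thesis using step[of "n - 1"] that by (auto simp: scheme_step_def)
    qed
    have level: "scheme_data \<Omega> ?V M ?H \<epsilon> dt (u (n - 1)) (u n) (U (n - 1)) (U n)" if "0 \<le> n" "n < N" for n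
      using that in_V[of n] in_V[of "n - 1"] adm[OF that] by (intro data) auto
    {
      fix n assume "0 < n \<and> n \<le> N"
      \<comment> \<open>Two consecutive levels are carried along because the mass balance is a two-step recurrence.\<close>
      have "int j \<le> N \<Longrightarrow> integral\<^sup>L (lebesgue_on \<Omega>) (u (int j)) = integral\<^sup>L (lebesgue_on \<Omega>) (u 0)
          \<and> integral\<^sup>L (lebesgue_on \<Omega>) (u (int j - 1)) = integral\<^sup>L (lebesgue_on \<Omega>) (u 0)" for j
      proof (induction j)
        case 0
        then show ?case using init(1) by simp
      next
        case (Suc j)
        then have "0 \<le> int j" "int j < N" by auto
        from scheme_data.scheme_step_mass[OF level[OF this] step[OF this]] Suc
        show ?case by (simp add: add.commute)
      qed
      from this[of "nat n"] \<open>0 < n \<and> n \<le> N\<close>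
      show "integral\<^sup>L (lebesgue_on \<Omega>) (u n) = integral\<^sup>L (lebesgue_on \<Omega>) (u 0)" by simp
    next
      fix n assume "0 \<le> n \<and> n < N"
      then have n: "0 \<le> n" "n < N" by auto
      from scheme_data.scheme_step_energy[OF level[OF n] step[OF n], of B]
      show "mean_energy \<Omega> \<epsilon> B u U (n + 1) =
          mean_energy \<Omega> \<epsilon> B u U n
          - dt * A_form \<Omega> (\<lambda>x. M (extrap (u (n - 1)) (u n) x)) (w (n + 1)) (w (n + 1))
          - 1/4 * A_form \<Omega> (\<lambda>x. \<epsilon>\<^sup>2)
              (\<lambda>x. u (n + 1) x - extrap (u (n - 1)) (u n) x)
              (\<lambda>x. u (n + 1) x - extrap (u (n - 1)) (u n) x)
          - 1/2 * (L2_norm \<Omega> (\<lambda>x. U (n + 1) x - extrap (U (n - 1)) (U n) x))\<^sup>2"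
        by (simp add: mean_energy_def)
    }
  qed
qed

end
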